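(* Let $\Omega = X\times\mathbb{R}^n$ with $X=\mathbb{R}^n$ or $X=\mathbb{T}^n$, and let $f,g\in C^\infty(\Omega)$ be strictly positive with $\int_\Omega f\,dx\,dv=\int_\Omega g\,dx\,dv$. Let $V=V(x)$ be a time-independent potential, and let $\rho=\rho(x,v,t)$ be the solution of the Liouville equation $$\partial_t\rho+v\cdot\nabla_x\rho-\nabla_xV(x)\cdot\nabla_v\rho=0,\qquad \rho(\cdot,0)=f,$$ such that $\rho(\cdot,1)=g$. Let $H(x,v)=\tfrac12|v|^2+V(x)$. Then for every measurable function $\Phi:\mathbb{R}\to\mathbb{R}$ it must hold that $$\int_\Omega \Phi(H(x,v))\,f(x,v)\,dx\,dv=\int_\Omega\Phi(H(x,v))\,g(x,v)\,dx\,dv.$$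
   Context: $\mathbb{T}^n$ is the $n$-dimensional torus; points of $\Omega$ are written $(x,v)$ with $x\in X$, $v\in\mathbb{R}^n$. Here $\rho(\cdot,t)$ denotes the function $(x,v)\mapsto\rho(x,v,t)$ on $\Omega$. The equation is the Liouville equation for the autonomous Hamiltonian system $\dot x=v$, $\dot v=-\nabla_xV(x)$, whose Hamiltonian is $H$.
   Formalization: V is taken C², and for X=ℝⁿ it is additionally assumed that the system x'=v, v'=-∇V(x) is solvable up to time 1 from every initial point; otherwise (e.g. V=-x⁴) mass can enter from infinity and the identity fails. *)

theory Defs
  imports "HOL-Analysis.Analysis"
begin

text \<open>Differentiability classes, for open \<open>S\<close>.\<close>

primrec Ck_on :: "nat \<Rightarrow> ('a::euclidean_space \<Rightarrow> real) \<Rightarrow> 'a set \<Rightarrow> bool" where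
  "Ck_on 0 f S \<longleftrightarrow> continuous_on S f"
| "Ck_on (Suc k) f S \<longleftrightarrow>
     (\<forall>x\<in>S. f differentiable (at x)) \<and>
     (\<forall>h. Ck_on k (\<lambda>x. frechet_derivative f (at x) h) S)"

definition smooth_on :: "('a::euclidean_space \<Rightarrow> real) \<Rightarrow> 'a set \<Rightarrow> bool" where
  "smooth_on f S \<longleftrightarrow> (\<forall>k. Ck_on k f S)"

definition grad :: "('a::real_inner \<Rightarrow> real) \<Rightarrow> 'a \<Rightarrow> 'a" where
  "grad f x = (THE D. GDERIV f x :> D)"

text \<open>
  The position space \<open>X\<close> is either \<open>\<real>\<^sup>n\<close> or \<open>\<real>\<^sup>n / \<int>\<^sup>n\<close>. A function on the torus is represented by its
  lift to \<open>\<real>\<^sup>n\<close>, which is 1-periodic in each coordinate, and integrals over the torus are taken over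
  the unit cell. Derivatives are those of the lift.
\<close>

datatype position_space = Euclidean | Torus

fun on_position_space :: "position_space \<Rightarrow> (real^'n \<Rightarrow> 'b) \<Rightarrow> bool" where
  "on_position_space Euclidean h \<longleftrightarrow> True"
| "on_position_space Torus h \<longleftrightarrow> (\<forall>x i. h (x + axis i 1) = h x)"

fun cell :: "position_space \<Rightarrow> (real^'n) set" where
  "cell Euclidean = UNIV"
| "cell Torus = {x. \<forall>i. 0 \<le> x $ i \<and> x $ i < 1}"

definition phase_measure :: "position_space \<Rightarrow> ((real^'n) \<times> (real^'n)) measure" where
  "phase_measure X = lebesgue_on (cell X \<times> UNIV)"

definition smooth_positive_density ::
    "position_space \<Rightarrow> ((real^'n) \<times> (real^'n) \<Rightarrow> real) \<Rightarrow> bool" where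
  "smooth_positive_density X f \<longleftrightarrow>
     on_position_space X (\<lambda>x v. f (x, v)) \<and> smooth_on f UNIV \<and> (\<forall>z. f z > 0)"

definition hamiltonian :: "(real^'n \<Rightarrow> real) \<Rightarrow> real^'n \<Rightarrow> real^'n \<Rightarrow> real" where
  "hamiltonian V x v = (norm v)\<^sup>2 / 2 + V x"

text \<open>
  The Hamiltonian system \<open>x' = v\<close>, \<open>v' = -\<nabla>V(x)\<close> can be solved up to time 1 from every initial point;
  since the system is autonomous and reversible, this amounts to the flow being complete. On the
  torus this always holds. On \<open>\<real>\<^sup>n\<close> it can fail (as for \<open>V(x) = -x\<^sup>4\<close>), and then the Cauchy problem
  for the Liouville equation is ill-posed: mass may enter from infinity.
\<close>

definition characteristics_exist :: "(real^'n \<Rightarrow> real) \<Rightarrow> bool" where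
  "characteristics_exist V \<longleftrightarrow>
     (\<forall>x0 v0. \<exists>\<xi> \<eta> :: real \<Rightarrow> real^'n. \<xi> 0 = x0 \<and> \<eta> 0 = v0 \<and>
        (\<forall>t\<in>{0..1}.
           (\<xi> has_vector_derivative \<eta> t) (at t within {0..1}) \<and>
           (\<eta> has_vector_derivative - grad V (\<xi> t)) (at t within {0..1})))"

text \<open>
  Classical solutions on the time interval \<open>[0, 1]\<close>: continuous up to both ends,
  continuously differentiable in between.
\<close>

definition liouville_solution ::
    "position_space \<Rightarrow> (real^'n \<Rightarrow> real) \<Rightarrow> ((real^'n) \<times> (real^'n) \<Rightarrow> real) \<Rightarrow>
     (real^'n \<Rightarrow> real^'n \<Rightarrow> real \<Rightarrow> real) \<Rightarrow> bool" where
  "liouville_solution X V f \<rho> \<longleftrightarrow>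
     (\<forall>t\<in>{0..1}. on_position_space X (\<lambda>x v. \<rho> x v t)) \<and>
     continuous_on (UNIV \<times> {0..1}) (\<lambda>((x, v), t). \<rho> x v t) \<and>
     Ck_on 1 (\<lambda>((x, v), t). \<rho> x v t) (UNIV \<times> {0<..<1}) \<and>
     (\<forall>x v. \<forall>t\<in>{0<..<1}.
        deriv (\<lambda>s. \<rho> x v s) t + v \<bullet> grad (\<lambda>y. \<rho> y v t) x
          - grad V x \<bullet> grad (\<lambda>w. \<rho> x w t) v = 0) \<and>
     (\<forall>x v. \<rho> x v 0 = f (x, v))"

end

theory Submission
  imports Defs
begin

text \<open>
  Let \<open>T\<close> be the time-1 map of \<open>x' = v\<close>, \<open>v' = F(x)\<close> with \<open>F = -\<nabla>V\<close>. Along trajectories both \<open>H\<close> and the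
  solution \<open>\<rho>\<close> are constant, so \<open>H \<circ> T = H\<close> and \<open>g \<circ> T = f\<close>; hence \<open>\<Phi>(H) f = (\<Phi>(H) g) \<circ> T\<close>, and the claim
  says that \<open>T\<close> preserves Lebesgue measure. This is proved without differentiating the flow: a step
  of the symplectic Euler scheme is a composition of two shears, so it preserves the measure, and its
  iterates converge pointwise to \<open>T\<close>. By Fatou's lemma and outer regularity \<open>|T\<inverse>(A)| \<le> |A|\<close>. The system
  is reversible, \<open>T\<inverse>\<close> being conjugate to \<open>T\<close> by \<open>(x, v) \<mapsto> (x, -v)\<close> and the limit of Euler steps of
  negative size, so the same bound holds for \<open>T\<inverse>\<close>, and equality follows. The convergence of the Euler
  scheme to every trajectory also shows that trajectories are unique. On the torus, \<open>F\<close> is globally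
  Lipschitz, so the flow exists; it commutes with lattice translations and descends to the unit cell.
\<close>

section \<open>Trajectories and symplectic Euler steps\<close>

text \<open>The force is evaluated at the already updated position. This semi-implicit form is what
  makes the step a composition of two shears; the explicit Euler step does not factor in this
  way.\<close>

definition euler_step :: "('a::real_normed_vector \<Rightarrow> 'a) \<Rightarrow> real \<Rightarrow> 'a \<times> 'a \<Rightarrow> 'a \<times> 'a" where
  "euler_step F h z = (fst z + h *\<^sub>R snd z, snd z + h *\<^sub>R F (fst z + h *\<^sub>R snd z))"

text \<open>An abstract force \<open>F\<close> takes the place of \<open>- grad V\<close>, so that
  the analysis of the flow is independent of the potential. Derivatives are one-sided at the ends of
  the time interval.\<close>

definition trajectory ::
    "('a::real_normed_vector \<Rightarrow> 'a) \<Rightarrow> (real \<Rightarrow> 'a) \<Rightarrow> (real \<Rightarrow> 'a) \<Rightarrow> bool" where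
  "trajectory F \<xi> \<eta> \<longleftrightarrow>
     (\<forall>t\<in>{0..1}.
        (\<xi> has_vector_derivative \<eta> t) (at t within {0..1}) \<and>
        (\<eta> has_vector_derivative F (\<xi> t)) (at t within {0..1}))"

text \<open>The time-1 map as a relation, because existence and uniqueness of the endpoint are
  established separately.\<close>

definition reaches :: "('a::real_normed_vector \<Rightarrow> 'a) \<Rightarrow> 'a \<times> 'a \<Rightarrow> 'a \<times> 'a \<Rightarrow> bool" where
  "reaches F z w \<longleftrightarrow> (\<exists>\<xi> \<eta>. trajectory F \<xi> \<eta> \<and> (\<xi> 0, \<eta> 0) = z \<and> (\<xi> 1, \<eta> 1) = w)"

text \<open>One constant per ball, rather than one near each point, serves a trajectory and its
  approximations simultaneously; in finite dimension the two notions agree.\<close>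

definition locally_lipschitz :: "('a::real_normed_vector \<Rightarrow> 'b::real_normed_vector) \<Rightarrow> bool" where
  "locally_lipschitz F \<longleftrightarrow> (\<forall>R. \<exists>L. L-lipschitz_on (cball 0 R) F)"

lemma locally_lipschitz_continuous:
  fixes F :: "'a::real_normed_vector \<Rightarrow> 'b::real_normed_vector"
  assumes "locally_lipschitz F"
  shows "continuous_on UNIV F"
proof (intro continuous_at_imp_continuous_on ballI)
  fix x :: 'a
  obtain L where "L-lipschitz_on (cball 0 (norm x + 1)) F"
    using assms unfolding locally_lipschitz_def by blast
  then have "continuous_on (ball 0 (norm x + 1)) F"
    using lipschitz_on_continuous_on continuous_on_subset ball_subset_cball by blast
  then show "isCont F x"
    by (rule continuous_on_interior) (auto simp: interior_open)
qed

section \<open>Symplectic Euler steps preserve Lebesgue measure\<close>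

lemma emeasure_lborel_translate:
  fixes A :: "'a::euclidean_space set"
  assumes "A \<in> sets borel"
  shows "emeasure lborel ((\<lambda>x. x + c) -` A) = emeasure lborel A"
proof -
  have "emeasure lborel A = emeasure (distr lborel borel ((+) c)) A"
    by (simp add: lborel_distr_plus)
  also have "\<dots> = emeasure lborel ((\<lambda>x. x + c) -` A)"
    using assms by (subst emeasure_distr) (auto simp: add.commute[of c] vimage_def)
  finally show ?thesis ..
qed

text \<open>By Tonelli the measure is the integral of the measures of the sections over
  \<open>x\<close>, and the shear merely translates each section by \<open>F x\<close>.\<close>

lemma emeasure_lborel_shear_snd:
  fixes A :: "('a::euclidean_space \<times> 'b::euclidean_space) set"
  assumes F: "F \<in> borel_measurable borel" and A: "A \<in> sets borel"
  shows "emeasure lborel ((\<lambda>z. (fst z, snd z + F (fst z))) -` A) = emeasure lborel A"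
proof -
  let ?S = "\<lambda>z::'a\<times>'b. (fst z, snd z + F (fst z))"
  have m: "?S \<in> measurable borel borel"
    using F by (auto simp: borel_prod[symmetric])
  have A': "A \<in> sets (lborel \<Otimes>\<^sub>M lborel)" and SA: "?S -` A \<in> sets (lborel \<Otimes>\<^sub>M lborel)"
    using A measurable_sets_borel[OF m A] by (simp_all only: lborel_prod sets_lborel)
  have sec: "Pair x -` A \<in> sets borel" for x
    using sets_Pair1[OF A'] by simp
  have "emeasure lborel (?S -` A) = (\<integral>\<^sup>+x. emeasure lborel (Pair x -` (?S -` A)) \<partial>lborel)"
    unfolding lborel_prod[symmetric] by (rule lborel.emeasure_pair_measure_alt[OF SA])
  also have "\<dots> = (\<integral>\<^sup>+x. emeasure lborel ((\<lambda>y. y + F x) -` (Pair x -` A)) \<partial>lborel)"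
    by (simp add: vimage_def)
  also have "\<dots> = (\<integral>\<^sup>+x. emeasure lborel (Pair x -` A) \<partial>lborel)"
    by (simp add: emeasure_lborel_translate sec)
  also have "\<dots> = emeasure lborel A"
    unfolding lborel_prod[symmetric] by (rule lborel.emeasure_pair_measure_alt[OF A', symmetric])
  finally show ?thesis .
qed

lemma emeasure_lborel_shear_fst:
  fixes A :: "('a::euclidean_space \<times> 'b::euclidean_space) set"
  assumes F: "F \<in> borel_measurable borel" and A: "A \<in> sets borel"
  shows "emeasure lborel ((\<lambda>z. (fst z + F (snd z), snd z)) -` A) = emeasure lborel A"
proof -
  let ?S = "\<lambda>z::'a\<times>'b. (fst z + F (snd z), snd z)"
  have m: "?S \<in> measurable borel borel"
    using F by (auto simp: borel_prod[symmetric])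
  have A': "A \<in> sets (lborel \<Otimes>\<^sub>M lborel)" and SA: "?S -` A \<in> sets (lborel \<Otimes>\<^sub>M lborel)"
    using A measurable_sets_borel[OF m A] by (simp_all only: lborel_prod sets_lborel)
  have sec: "(\<lambda>x. (x, y)) -` A \<in> sets borel" for y
    using sets_Pair2[OF A'] by simp
  have "emeasure lborel (?S -` A) = (\<integral>\<^sup>+y. emeasure lborel ((\<lambda>x. (x, y)) -` (?S -` A)) \<partial>lborel)"
    unfolding lborel_prod[symmetric] by (rule lborel_pair.emeasure_pair_measure_alt2[OF SA])
  also have "\<dots> = (\<integral>\<^sup>+y. emeasure lborel ((\<lambda>x. x + F y) -` ((\<lambda>x. (x, y)) -` A)) \<partial>lborel)"
    by (simp add: vimage_def)
  also have "\<dots> = (\<integral>\<^sup>+y. emeasure lborel ((\<lambda>x. (x, y)) -` A) \<partial>lborel)"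
    by (simp add: emeasure_lborel_translate sec)
  also have "\<dots> = emeasure lborel A"
    unfolding lborel_prod[symmetric] by (rule lborel_pair.emeasure_pair_measure_alt2[OF A', symmetric])
  finally show ?thesis .
qed

lemma continuous_on_euler_step:
  assumes "continuous_on UNIV F"
  shows "continuous_on UNIV (euler_step F h)"
proof -
  have *: "continuous_on UNIV (\<lambda>z. F (fst z + h *\<^sub>R snd z))"
    by (rule continuous_on_compose2[OF assms]) (auto intro!: continuous_intros)
  show ?thesis
    unfolding euler_step_def by (intro continuous_intros *)
qed

text \<open>A drift of the position at fixed velocity, then a kick of the velocity at fixed
  position; both are shears.\<close>

lemma emeasure_euler_step:
  fixes F :: "'a::euclidean_space \<Rightarrow> 'a"
  assumes F: "continuous_on UNIV F" and A: "A \<in> sets borel"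
  shows "emeasure lborel (euler_step F h -` A) = emeasure lborel A"
proof -
  let ?S = "\<lambda>z::'a\<times>'a. (fst z, snd z + h *\<^sub>R F (fst z))"
  let ?P = "\<lambda>z::'a\<times>'a. (fst z + h *\<^sub>R snd z, snd z)"
  have Fm: "F \<in> borel_measurable borel"
    using F by (rule borel_measurable_continuous_onI)
  have "continuous_on UNIV (\<lambda>z::'a\<times>'a. F (fst z))"
    by (rule continuous_on_compose2[OF F]) (auto intro!: continuous_intros)
  then have "continuous_on UNIV ?S"
    by (intro continuous_intros)
  then have SA: "?S -` A \<in> sets borel"
    using borel_measurable_continuous_onI measurable_sets_borel A by blast
  have "euler_step F h -` A = ?P -` (?S -` A)"
    by (auto simp: euler_step_def)
  also have "emeasure lborel \<dots> = emeasure lborel (?S -` A)"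
    by (rule emeasure_lborel_shear_fst[OF _ SA, of "\<lambda>v. h *\<^sub>R v"]) auto
  also have "\<dots> = emeasure lborel A"
    using emeasure_lborel_shear_snd[OF _ A, of "\<lambda>x. h *\<^sub>R F x"] Fm by auto
  finally show ?thesis .
qed

lemma continuous_on_funpow:
  assumes "continuous_on UNIV (f :: 'a::topological_space \<Rightarrow> 'a)"
  shows "continuous_on UNIV (f ^^ k)"
proof (induction k)
  case (Suc k)
  then show ?case
    using continuous_on_compose2[OF assms Suc] by simp
qed auto

lemma emeasure_euler_iterate:
  fixes F :: "'a::euclidean_space \<Rightarrow> 'a"
  assumes F: "continuous_on UNIV F" and A: "A \<in> sets borel"
  shows "emeasure lborel ((euler_step F h ^^ k) -` A) = emeasure lborel A"
proof (induction k)
  case (Suc k)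
  have "(euler_step F h ^^ k) -` A \<in> sets borel"
    using continuous_on_funpow[OF continuous_on_euler_step[OF F]]
      borel_measurable_continuous_onI measurable_sets_borel A by blast
  from emeasure_euler_step[OF F this] Suc.IH show ?case
    by (simp only: funpow_Suc_right vimage_comp[symmetric])
qed (simp add: id_def)

text \<open>Fatou's lemma gives the claim for open sets, outer regularity extends it to Borel sets.\<close>

lemma emeasure_vimage_limit_le:
  fixes T :: "'a::euclidean_space \<Rightarrow> 'a"
  assumes S: "\<And>n. continuous_on UNIV (S n)"
    and pres: "\<And>n A. A \<in> sets borel \<Longrightarrow> emeasure lborel (S n -` A) = emeasure lborel A"
    and lim: "\<And>z. (\<lambda>n. S n z) \<longlonglongrightarrow> T z"
    and A: "A \<in> sets borel"
  shows "emeasure lborel (T -` A) \<le> emeasure lborel A"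
proof -
  have Sm: "S n \<in> borel_measurable borel" for n
    using S by (rule borel_measurable_continuous_onI)
  then have T: "T \<in> borel_measurable borel"
    using lim by (rule borel_measurable_LIMSEQ_metric)
  have op: "emeasure lborel (T -` U) \<le> emeasure lborel U" if "open U" for U
  proof -
    have U: "U \<in> sets borel" using that by simp
    have meas: "S n -` U \<in> sets borel" "T -` U \<in> sets borel" for n
      using measurable_sets_borel[OF Sm U] measurable_sets_borel[OF T U] by auto
    have "emeasure lborel (T -` U) = (\<integral>\<^sup>+z. indicator (T -` U) z \<partial>lborel)"
      using meas by simp
    also have "\<dots> \<le> (\<integral>\<^sup>+z. liminf (\<lambda>n. indicator (S n -` U) z) \<partial>lborel)"
    proof (rule nn_integral_mono)
      fix z
      show "indicator (T -` U) z \<le> liminf (\<lambda>n. indicator (S n -` U) z :: ennreal)"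
      proof (cases "T z \<in> U")
        case True
        then have "\<forall>\<^sub>F n in sequentially. S n z \<in> U"
          using lim[of z] that topological_tendstoD by blast
        then have "1 \<le> liminf (\<lambda>n. indicator (S n -` U) z :: ennreal)"
          by (intro Liminf_bounded) (auto elim: eventually_mono)
        with True show ?thesis by simp
      qed simp
    qed
    also have "\<dots> \<le> liminf (\<lambda>n. \<integral>\<^sup>+z. indicator (S n -` U) z \<partial>lborel)"
      by (rule nn_integral_liminf) (use meas in auto)
    also have "\<dots> = emeasure lborel U"
      using meas by (simp add: pres U Liminf_const)
    finally show ?thesis .
  qed
  show ?thesis
  proof (rule ennreal_le_epsilon)
    fix e :: real assume "0 < e"
    then obtain U where U: "open U" "A \<subseteq> U" "emeasure lborel (U - A) < e"
      using outer_regular_lborel[OF A] by blast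
    have "emeasure lborel (T -` A) \<le> emeasure lborel (T -` U)"
      using U T measurable_sets_borel[OF T, of U] by (intro emeasure_mono) auto
    also have "\<dots> \<le> emeasure lborel U" by (rule op[OF U(1)])
    also have "\<dots> = emeasure lborel (A \<union> (U - A))" using U(2) by (simp add: Un_absorb1)
    also have "\<dots> \<le> emeasure lborel A + emeasure lborel (U - A)"
      using U A by (intro emeasure_subadditive) auto
    also have "\<dots> \<le> emeasure lborel A + e"
      using U(3) by (intro add_left_mono) auto
    finally show "emeasure lborel (T -` A) \<le> emeasure lborel A + e" .
  qed
qed

section \<open>Convergence of the Euler scheme\<close>

text \<open>The mean value inequality for \<open>\<phi> s - s *\<^sub>R c\<close>. With
  \<open>c = 0\<close> it bounds an increment; with \<open>c\<close> the slope used by the scheme it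
  bounds the local error.\<close>

lemma norm_increment_le:
  fixes \<phi> :: "real \<Rightarrow> 'a::real_normed_vector"
  assumes "a \<le> b"
    and d: "\<And>s. s \<in> {a..b} \<Longrightarrow> (\<phi> has_vector_derivative \<phi>' s) (at s within {a..b})"
    and B: "\<And>s. s \<in> {a..b} \<Longrightarrow> norm (\<phi>' s - c) \<le> B"
  shows "norm (\<phi> b - \<phi> a - (b - a) *\<^sub>R c) \<le> B * (b - a)"
proof -
  have 1: "((\<lambda>s. \<phi> s - s *\<^sub>R c) has_derivative (\<lambda>h. h *\<^sub>R (\<phi>' s - c))) (at s within {a..b})"
    if "s \<in> {a..b}" for s
    using d[OF that] by (auto intro!: derivative_eq_intros simp: has_vector_derivative_def algebra_simps)
  have 2: "onorm (\<lambda>h::real. h *\<^sub>R (\<phi>' s - c)) \<le> B" if "s \<in> {a..b}" for s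
    using B[OF that] by (intro onorm_le) (simp add: mult.commute[of B] mult_left_mono)
  have "norm ((\<phi> b - b *\<^sub>R c) - (\<phi> a - a *\<^sub>R c)) \<le> B * norm (b - a)"
    by (rule differentiable_bound[where S = "{a..b}", OF _ 1 2]) (use \<open>a \<le> b\<close> in auto)
  with \<open>a \<le> b\<close> show ?thesis by (simp add: algebra_simps)
qed

lemma trajectory_continuous:
  assumes "trajectory F \<xi> \<eta>"
  shows "continuous_on {0..1} \<xi>" "continuous_on {0..1} \<eta>"
  using assms unfolding trajectory_def continuous_on_eq_continuous_within
  by (blast intro: has_vector_derivative_continuous)+

text \<open>Local error of second order: over a time \<open>h\<close> the slope
  \<open>\<eta>\<close> varies by at most \<open>B * h\<close> and the slope
  \<open>F (\<xi> t)\<close> by at most \<open>L * K * h\<close>. The force is compared with its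
  value at the right end, where the scheme evaluates it.\<close>

lemma trajectory_one_step:
  fixes F :: "'a::euclidean_space \<Rightarrow> 'a"
  assumes tr: "trajectory F \<xi> \<eta>"
    and L: "L-lipschitz_on (cball 0 K) F"
    and K: "\<And>t. t \<in> {0..1} \<Longrightarrow> norm (\<xi> t) \<le> K" "\<And>t. t \<in> {0..1} \<Longrightarrow> norm (\<eta> t) \<le> K"
    and B: "\<And>x. norm x \<le> K \<Longrightarrow> norm (F x) \<le> B"
    and st: "0 \<le> s" "0 \<le> h" "s + h \<le> 1"
  shows "norm (\<xi> (s + h) - \<xi> s - h *\<^sub>R \<eta> s) \<le> B * h\<^sup>2"
    and "norm (\<eta> (s + h) - \<eta> s - h *\<^sub>R F (\<xi> (s + h))) \<le> L * K * h\<^sup>2"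
proof -
  have sub: "{a..b} \<subseteq> {0..1}" if "s \<le> a" "b \<le> s + h" for a b
    using that st by auto
  have d\<xi>: "(\<xi> has_vector_derivative \<eta> t) (at t within {a..b})"
    and d\<eta>: "(\<eta> has_vector_derivative F (\<xi> t)) (at t within {a..b})"
    if "s \<le> a" "b \<le> s + h" "t \<in> {a..b}" for a b t
    using tr sub[OF that(1,2)] that(3) unfolding trajectory_def
    by (meson has_vector_derivative_within_subset subsetD)+
  have Kb: "norm (\<xi> t) \<le> K" "norm (\<eta> t) \<le> K" if "s \<le> t" "t \<le> s + h" for t
    using K[of t] that st by auto
  have lip: "norm (F x - F y) \<le> L * norm (x - y)" if "norm x \<le> K" "norm y \<le> K" for x y
    using lipschitz_on_normD[OF L, of x y] that by simp
  have "0 \<le> L" using L by (rule lipschitz_on_nonneg)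
  have "0 \<le> B" using order_trans[OF norm_ge_zero B[OF Kb(1)[of s]]] st by simp
  have "0 \<le> K" using order_trans[OF norm_ge_zero Kb(1)[of s]] st by simp
  have \<eta>_mod: "norm (\<eta> t - \<eta> s) \<le> B * h" if "t \<in> {s..s + h}" for t
  proof -
    have "norm (\<eta> t - \<eta> s - (t - s) *\<^sub>R 0) \<le> B * (t - s)"
      by (rule norm_increment_le[where \<phi>' = "\<lambda>t. F (\<xi> t)"]) (use that in \<open>auto intro!: d\<eta> B Kb\<close>)
    also have "\<dots> \<le> B * h" using that \<open>0 \<le> B\<close> by (intro mult_left_mono) auto
    finally show ?thesis by simp
  qed
  have "norm (\<xi> (s + h) - \<xi> s - (s + h - s) *\<^sub>R \<eta> s) \<le> B * h * (s + h - s)"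
    by (rule norm_increment_le[where \<phi>' = \<eta>]) (use st in \<open>auto intro!: d\<xi> \<eta>_mod\<close>)
  then show "norm (\<xi> (s + h) - \<xi> s - h *\<^sub>R \<eta> s) \<le> B * h\<^sup>2"
    by (simp add: power2_eq_square)
  have \<xi>_mod: "norm (F (\<xi> t) - F (\<xi> (s + h))) \<le> L * K * h" if t: "t \<in> {s..s + h}" for t
  proof -
    have "norm (\<xi> (s + h) - \<xi> t - (s + h - t) *\<^sub>R 0) \<le> K * (s + h - t)"
      by (rule norm_increment_le[where \<phi>' = \<eta>]) (use t in \<open>auto intro!: d\<xi> Kb\<close>)
    also have "\<dots> \<le> K * h" using t \<open>0 \<le> K\<close> by (intro mult_left_mono) auto
    finally have "norm (\<xi> t - \<xi> (s + h)) \<le> K * h" by (simp add: norm_minus_commute)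
    then have "L * norm (\<xi> t - \<xi> (s + h)) \<le> L * (K * h)"
      using \<open>0 \<le> L\<close> by (rule mult_left_mono)
    with lip[of "\<xi> t" "\<xi> (s + h)"] Kb t st show ?thesis by (fastforce simp: mult.assoc)
  qed
  have "norm (\<eta> (s + h) - \<eta> s - (s + h - s) *\<^sub>R F (\<xi> (s + h))) \<le> L * K * h * (s + h - s)"
    by (rule norm_increment_le[where \<phi>' = "\<lambda>t. F (\<xi> t)"]) (use st in \<open>auto intro!: d\<eta> \<xi>_mod\<close>)
  then show "norm (\<eta> (s + h) - \<eta> s - h *\<^sub>R F (\<xi> (s + h))) \<le> L * K * h\<^sup>2"
    by (simp add: power2_eq_square mult.assoc)
qed

text \<open>Propagation of the error through one step: the Lipschitz bound amplifies the old error
  \<open>e\<close> by a factor \<open>1 + O(h)\<close>, and the local errors are added. The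
  condition \<open>e \<le> 1\<close> keeps the numerical point in the ball where \<open>L\<close> is
  valid.\<close>

lemma euler_error_step:
  fixes F :: "'a::euclidean_space \<Rightarrow> 'a"
  assumes L: "L-lipschitz_on (cball 0 R) F"
    and h: "0 \<le> h" "h \<le> 1"
    and K: "norm x \<le> K" "norm v \<le> K" "norm x' \<le> K" "R \<ge> 2 * K + 2"
    and 1: "norm (x' - x - h *\<^sub>R v) \<le> B * h\<^sup>2"
    and 2: "norm (v' - v - h *\<^sub>R F x') \<le> C * h\<^sup>2"
    and e: "norm (y - x) + norm (w - v) \<le> e" "e \<le> 1"
  defines "z \<equiv> euler_step F h (y, w)"
  shows "norm (fst z - x') + norm (snd z - v') \<le> (1 + (1 + L) * h) * e + ((1 + L) * B + C) * h\<^sup>2"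
proof -
  have "0 \<le> L" using L by (rule lipschitz_on_nonneg)
  have z: "fst z = y + h *\<^sub>R w" "snd z = w + h *\<^sub>R F (fst z)"
    by (simp_all add: z_def euler_step_def)
  have K0: "0 \<le> K" using K(1) norm_ge_zero order_trans by blast
  have e': "norm (y - x) \<le> 1" "norm (w - v) \<le> 1"
    using e norm_ge_zero[of "y - x"] norm_ge_zero[of "w - v"] by linarith+
  have yw: "norm y \<le> K + 1" "norm w \<le> K + 1"
    using e' K norm_triangle_sub[of y x] norm_triangle_sub[of w v] by linarith+
  \<comment> \<open>As \<open>h \<le> 1\<close>, the drift moves the position by at most
    \<open>K + 1\<close>, hence to within radius \<open>2 * K + 2\<close>.\<close>
  have "norm (h *\<^sub>R w) \<le> 1 * (K + 1)"
    using h yw by (simp only: norm_scaleR) (intro mult_mono, auto)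
  then have "norm (fst z) \<le> R"
    using norm_triangle_ineq[of y "h *\<^sub>R w"] yw K(4) by (simp add: z)
  moreover have "norm x' \<le> R" using K K0 by linarith
  ultimately have lip: "norm (F (fst z) - F x') \<le> L * norm (fst z - x')"
    using lipschitz_on_normD[OF L, of "fst z" x'] by simp
  have "fst z - x' = (y - x) + h *\<^sub>R (w - v) - (x' - x - h *\<^sub>R v)"
    by (simp add: z algebra_simps)
  then have "norm (fst z - x') \<le> norm (y - x) + norm (h *\<^sub>R (w - v)) + norm (x' - x - h *\<^sub>R v)"
    by (metis (no_types) norm_triangle_ineq norm_triangle_ineq4 add_right_mono order_trans)
  then have a: "norm (fst z - x') \<le> norm (y - x) + h * norm (w - v) + B * h\<^sup>2"
    using 1 h by simp
  have "snd z - v' = (w - v) + h *\<^sub>R (F (fst z) - F x') - (v' - v - h *\<^sub>R F x')"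
    by (simp add: z(2) algebra_simps)
  then have "norm (snd z - v') \<le> norm (w - v) + norm (h *\<^sub>R (F (fst z) - F x')) + norm (v' - v - h *\<^sub>R F x')"
    by (metis (no_types) norm_triangle_ineq norm_triangle_ineq4 add_right_mono order_trans)
  also have "\<dots> \<le> norm (w - v) + h * (L * norm (fst z - x')) + C * h\<^sup>2"
    using lip h 2 by (auto intro!: add_mono mult_left_mono)
  finally have b: "norm (snd z - v') \<le> norm (w - v) + h * L * norm (fst z - x') + C * h\<^sup>2"
    by (simp add: mult.assoc)
  let ?a = "norm (y - x)" and ?b = "norm (w - v)"
  have hL: "0 \<le> h * L" "h * L \<le> L"
    using \<open>0 \<le> L\<close> h by (auto simp: mult_left_le_one_le)
  have B: "0 \<le> B * h\<^sup>2" using 1 norm_ge_zero order_trans by blast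
  have "norm (fst z - x') + norm (snd z - v') \<le> (1 + h * L) * norm (fst z - x') + ?b + C * h\<^sup>2"
    using b by (simp add: algebra_simps)
  also have "\<dots> \<le> (1 + h * L) * (?a + h * ?b + B * h\<^sup>2) + ?b + C * h\<^sup>2"
    using a hL by (intro add_right_mono mult_left_mono) auto
  also have "\<dots> = (1 + h * L) * ?a + (1 + h * (1 + h * L)) * ?b + (1 + h * L) * (B * h\<^sup>2) + C * h\<^sup>2"
    by (simp add: algebra_simps)
  also have "\<dots> \<le> (1 + (1 + L) * h) * ?a + (1 + (1 + L) * h) * ?b + (1 + L) * (B * h\<^sup>2) + C * h\<^sup>2"
  proof -
    have *: "1 + h * L \<le> 1 + (1 + L) * h" using h by (simp add: algebra_simps)
    \<comment> \<open>Since \<open>h \<le> 1\<close>, the quadratic term \<open>h * (h * L)\<close>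
      is absorbed into \<open>h * L\<close>.\<close>
    have **: "1 + h * (1 + h * L) \<le> 1 + (1 + L) * h"
      using mult_left_mono[OF hL(2) h(1)] by (simp add: algebra_simps)
    show ?thesis
      by (rule add_right_mono[OF add_mono[OF add_mono]]; rule mult_right_mono)
        (use * ** B hL in auto)
  qed
  also have "\<dots> = (1 + (1 + L) * h) * (?a + ?b) + ((1 + L) * B + C) * h\<^sup>2"
    by (simp add: algebra_simps)
  also have "\<dots> \<le> (1 + (1 + L) * h) * e + ((1 + L) * B + C) * h\<^sup>2"
    using e(1) \<open>0 \<le> L\<close> h by (intro add_right_mono mult_left_mono) auto
  finally show ?thesis .
qed

text \<open>A discrete Gronwall argument: \<open>N\<close> steps of size \<open>1 / N\<close>, each
  contributing an error of order \<open>1 / N\<^sup>2\<close> that later steps amplify by a bounded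
  factor, leave a total error of order \<open>1 / N\<close>.\<close>

lemma euler_tendsto_trajectory:
  fixes F :: "'a::euclidean_space \<Rightarrow> 'a"
  assumes tr: "trajectory F \<xi> \<eta>" and lip: "locally_lipschitz F"
  shows "(\<lambda>N. (euler_step F (1 / N) ^^ N) (\<xi> 0, \<eta> 0)) \<longlonglongrightarrow> (\<xi> 1, \<eta> 1)"
proof -
  have "compact (\<xi> ` {0..1} \<union> \<eta> ` {0..1})"
    using trajectory_continuous[OF tr] by (auto intro!: compact_continuous_image)
  then obtain K where "\<forall>x\<in>\<xi> ` {0..1} \<union> \<eta> ` {0..1}. norm x \<le> K"
    using compact_imp_bounded bounded_iff by metis
  then have K: "\<And>t. t \<in> {0..1} \<Longrightarrow> norm (\<xi> t) \<le> K" "\<And>t. t \<in> {0..1} \<Longrightarrow> norm (\<eta> t) \<le> K"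
    by auto
  define R where "R = 2 * K + 2"
  have "0 \<le> K" using K(1)[of 0] norm_ge_zero[of "\<xi> 0"] by (simp del: norm_ge_zero)
  obtain L where L: "L-lipschitz_on (cball 0 R) F"
    using lip unfolding locally_lipschitz_def by blast
  then have LK: "L-lipschitz_on (cball 0 K) F"
    by (rule lipschitz_on_subset) (use \<open>0 \<le> K\<close> in \<open>auto simp: R_def\<close>)
  have "0 \<le> L" using L by (rule lipschitz_on_nonneg)
  have "compact (F ` cball 0 K)"
    using lipschitz_on_continuous_on[OF LK] by (intro compact_continuous_image) auto
  then obtain B where B: "\<And>x. norm x \<le> K \<Longrightarrow> norm (F x) \<le> B"
    by (metis bounded_iff compact_imp_bounded imageI mem_cball_0)
  have "0 \<le> B" using order_trans[OF norm_ge_zero B[of 0]] \<open>0 \<le> K\<close> by simp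
  define c where "c = 1 + L"
  define C where "C = c * B + L * K"
  have C: "0 \<le> c" "0 \<le> C" using \<open>0 \<le> L\<close> \<open>0 \<le> B\<close> \<open>0 \<le> K\<close> by (auto simp: c_def C_def)
  define E where "E N = C * exp c / real N" for N
  define z where "z N k = (euler_step F (1 / N) ^^ k) (\<xi> 0, \<eta> 0)" for N k :: nat
  define d where "d N k = norm (fst (z N k) - \<xi> (k / N)) + norm (snd (z N k) - \<eta> (k / N))" for N k :: nat
  have E: "E \<longlonglongrightarrow> 0"
    unfolding E_def by (rule lim_const_over_n)
  \<comment> \<open>For large \<open>N\<close> the final bound \<open>E N\<close> is at most 1. As
    it dominates all intermediate bounds, the smallness condition of the one-step estimate holds
    throughout the induction.\<close>
  have bound: "d N N \<le> E N" if N: "N > 0" "E N \<le> 1" for N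
  proof -
    define h where "h = 1 / real N"
    have h: "0 \<le> h" "h \<le> 1" using N by (auto simp: h_def)
    \<comment> \<open>A majorant for the recursion with factor \<open>1 + c * h\<close> and
      increment \<open>C * h\<^sup>2\<close>: there are \<open>k\<close> local errors, each counted
      with the largest amplification.\<close>
    define e where "e k = k * (C * h\<^sup>2 * (1 + c * h) ^ k)" for k :: nat
    have eE: "e k \<le> E N" if "k \<le> N" for k
    proof -
      have "(1 + c * h) ^ k \<le> exp (c * h) ^ k"
        using C h exp_ge_add_one_self[of "c * h"] by (intro power_mono) auto
      also have "\<dots> = exp (k * (c * h))" by (simp add: exp_of_nat_mult)
      also have "\<dots> \<le> exp c"
        using that N mult_left_mono[of "real k / real N" 1 c] C by (simp add: h_def mult.commute)
      finally have *: "C * h\<^sup>2 * (1 + c * h) ^ k \<le> C * h\<^sup>2 * exp c"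
        using C by (intro mult_left_mono) auto
      have "e k \<le> real N * (C * h\<^sup>2 * exp c)"
        unfolding e_def by (rule mult_mono[OF _ *]) (use that C h in auto)
      also have "\<dots> = E N" using N by (simp add: E_def h_def power2_eq_square)
      finally show ?thesis .
    qed
    have "d N k \<le> e k" if "k \<le> N" for k
      using that
    proof (induction k)
      case 0
      then show ?case by (simp add: d_def e_def z_def)
    next
      case (Suc k)
      let ?s = "real k / real N"
      have s: "0 \<le> ?s" "?s + h \<le> 1" "?s + h = real (Suc k) / real N"
        using Suc.prems N by (auto simp: h_def field_simps)
      have "?s \<in> {0..1}" "?s + h \<in> {0..1}" using s h by auto
      note * = euler_error_step[OF L h K(1,2)[OF this(1)] K(1)[OF this(2)] _
          trajectory_one_step[OF tr LK K B s(1) h(1) s(2)], of "fst (z N k)" "snd (z N k)" "e k"]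
      have "euler_step F h (z N k) = z N (Suc k)"
        by (simp add: z_def h_def)
      moreover have "d N k \<le> e k" "e k \<le> 1"
        using Suc eE[of k] N by auto
      ultimately have "d N (Suc k) \<le> (1 + c * h) * e k + C * h\<^sup>2"
        using * unfolding s(3) by (simp add: d_def c_def C_def R_def)
      \<comment> \<open>Enlarging the newest local error by the full amplification makes the sum
        exactly \<open>e (Suc k)\<close>.\<close>
      also have "C * h\<^sup>2 = C * h\<^sup>2 * 1" by simp
      also have "\<dots> \<le> C * h\<^sup>2 * (1 + c * h) ^ Suc k"
        using C h by (intro mult_left_mono one_le_power) auto
      also have "(1 + c * h) * e k + \<dots> = e (Suc k)"
        by (simp add: e_def algebra_simps)
      finally show ?case by simp
    qed
    from this[of N] eE[of N] show ?thesis by simp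
  qed
  have "\<forall>\<^sub>F N in sequentially. norm (z N N - (\<xi> 1, \<eta> 1)) \<le> E N"
    using order_tendstoD(2)[OF E zero_less_one] eventually_gt_at_top[of 0]
  proof eventually_elim
    case (elim N)
    have "norm (z N N - (\<xi> 1, \<eta> 1)) \<le> d N N"
      using elim norm_Pair_le[of "fst (z N N) - \<xi> 1" "snd (z N N) - \<eta> 1"]
      by (simp add: d_def minus_prod_def)
    with bound[of N] elim show ?case by simp
  qed
  then have "(\<lambda>N. z N N - (\<xi> 1, \<eta> 1)) \<longlonglongrightarrow> 0"
    using E by (rule Lim_null_comparison)
  then show ?thesis by (simp add: z_def LIM_zero_cancel)
qed

section \<open>Uniqueness and symmetries of trajectories\<close>

lemma reaches_euler:
  fixes F :: "'a::euclidean_space \<Rightarrow> 'a"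
  assumes "reaches F z w" "locally_lipschitz F"
  shows "(\<lambda>N. (euler_step F (1 / N) ^^ N) z) \<longlonglongrightarrow> w"
  using assms euler_tendsto_trajectory unfolding reaches_def by blast

text \<open>The Euler sequence depends only on the starting point, so both endpoints are limits of
  one sequence.\<close>

lemma reaches_unique:
  fixes F :: "'a::euclidean_space \<Rightarrow> 'a"
  assumes "reaches F z w" "reaches F z w'" "locally_lipschitz F"
  shows "w = w'"
  using assms LIMSEQ_unique reaches_euler by blast

text \<open>Running time backwards changes the sign of the velocity but not of the acceleration, and
  the force depends on the position alone.\<close>

lemma reaches_reverse:
  assumes "reaches F (x, v) (y, w)"
  shows "reaches F (y, - w) (x, - v)"
proof -
  obtain \<xi> \<eta> where tr: "trajectory F \<xi> \<eta>" and ends: "\<xi> 0 = x" "\<eta> 0 = v" "\<xi> 1 = y" "\<eta> 1 = w"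
    using assms by (auto simp: reaches_def)
  have *: "((\<lambda>t. \<phi> (1 - t)) has_vector_derivative - d) (at t within {0..1})"
    if "(\<phi> has_vector_derivative d) (at (1 - t) within {0..1})" for \<phi> :: "real \<Rightarrow> 'a" and d t
  proof -
    have img: "(\<lambda>t. 1 - t) ` {0..1} = {0..1::real}"
      by (auto intro!: image_eqI[where x = "1 - _"])
    have "((\<lambda>t. 1 - t) has_vector_derivative - 1) (at t within {0..1})"
      by (auto intro!: derivative_eq_intros)
    from vector_diff_chain_within[OF this, of \<phi> d] that show ?thesis
      by (simp add: img comp_def)
  qed
  have "trajectory F (\<lambda>t. \<xi> (1 - t)) (\<lambda>t. - \<eta> (1 - t))"
    unfolding trajectory_def
  proof (intro ballI conjI)
    fix t :: real assume "t \<in> {0..1}"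
    then have t: "1 - t \<in> {0..1}" by auto
    show "((\<lambda>t. \<xi> (1 - t)) has_vector_derivative - \<eta> (1 - t)) (at t within {0..1})"
      using tr t by (intro *) (auto simp: trajectory_def)
    have "((\<lambda>t. \<eta> (1 - t)) has_vector_derivative - F (\<xi> (1 - t))) (at t within {0..1})"
      using tr t by (intro *) (auto simp: trajectory_def)
    then show "((\<lambda>t. - \<eta> (1 - t)) has_vector_derivative F (\<xi> (1 - t))) (at t within {0..1})"
      using has_vector_derivative_minus by fastforce
  qed
  with ends show ?thesis
    unfolding reaches_def by (intro exI[of _ "\<lambda>t. \<xi> (1 - t)"] exI[of _ "\<lambda>t. - \<eta> (1 - t)"]) auto
qed

lemma reaches_translate:
  assumes "reaches F (x, v) (y, w)" and F: "\<And>x. F (x + k) = F x"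
  shows "reaches F (x + k, v) (y + k, w)"
proof -
  obtain \<xi> \<eta> where tr: "trajectory F \<xi> \<eta>" and ends: "\<xi> 0 = x" "\<eta> 0 = v" "\<xi> 1 = y" "\<eta> 1 = w"
    using assms by (auto simp: reaches_def)
  have "trajectory F (\<lambda>t. \<xi> t + k) \<eta>"
    using tr by (auto simp: trajectory_def F intro!: derivative_eq_intros)
  with ends show ?thesis
    unfolding reaches_def by (intro exI[of _ "\<lambda>t. \<xi> t + k"] exI[of _ \<eta>]) auto
qed

section \<open>The flow\<close>

text \<open>The description denotes the time-1 endpoint as soon as that endpoint exists and is
  unique.\<close>

definition flow_map :: "('a::real_normed_vector \<Rightarrow> 'a) \<Rightarrow> 'a \<times> 'a \<Rightarrow> 'a \<times> 'a" where
  "flow_map F z = (THE w. reaches F z w)"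

text \<open>Time reversal on phase space: it conjugates the time-1 map to its inverse.\<close>

definition flip :: "'a \<times> 'a \<Rightarrow> 'a \<times> 'a::real_normed_vector" where
  "flip z = (fst z, - snd z)"

lemma flip_flip [simp]: "flip (flip z) = z"
  by (simp add: flip_def)

lemma flow_map_eqI:
  fixes F :: "'a::euclidean_space \<Rightarrow> 'a"
  assumes "locally_lipschitz F" "reaches F z w"
  shows "flow_map F z = w"
  using assms reaches_unique unfolding flow_map_def by blast

text \<open>The signs of step size and velocity cancel in the position, so the force is evaluated at
  the same point on both sides.\<close>

lemma euler_step_flip: "euler_step F (- h) (flip z) = flip (euler_step F h z)"
  by (simp add: euler_step_def flip_def)

lemma euler_iterate_flip: "(euler_step F (- h) ^^ k) (flip z) = flip ((euler_step F h ^^ k) z)"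
  by (induction k) (simp_all add: euler_step_flip)

text \<open>The common ground of the two position spaces: on \<open>\<real>^n\<close> completeness
  comes from the hypothesis on characteristics, on the torus from periodicity of the force.\<close>

locale complete_newton_flow =
  fixes F :: "'a::euclidean_space \<Rightarrow> 'a"
  assumes lip: "locally_lipschitz F"
    and complete: "\<exists>w. reaches F z w"
begin

abbreviation "T \<equiv> flow_map F"

abbreviation "T_inv \<equiv> \<lambda>z. flip (flow_map F (flip z))"

lemma reaches_flow_map: "reaches F z (T z)"
  using complete[of z] flow_map_eqI[OF lip] by metis

text \<open>The reversed trajectory leads from \<open>flip (T z)\<close> to \<open>flip z\<close>,
  and endpoints are unique.\<close>

lemma flow_map_inverse: "T_inv (T z) = z"
proof -
  have "reaches F (flip (T z)) (flip z)"
    using reaches_reverse[of F "fst z" "snd z" "fst (T z)" "snd (T z)"] reaches_flow_map[of z]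
    by (simp add: flip_def)
  then show ?thesis using flow_map_eqI[OF lip] by fastforce
qed

lemma flow_map_inverse': "T (T_inv z) = z"
  using flow_map_inverse[of "flip z"] by (metis flip_flip)

lemma flow_map_translate:
  assumes "\<And>x. F (x + k) = F x"
  shows "T (z + (k, 0)) = T z + (k, 0)"
  by (rule flow_map_eqI[OF lip])
    (use reaches_translate[of F "fst z" "snd z" "fst (T z)" "snd (T z)" k] assms reaches_flow_map[of z]
     in \<open>simp add: plus_prod_def\<close>)

lemma euler_tendsto_flow_map: "(\<lambda>N. (euler_step F (1 / N) ^^ N) z) \<longlonglongrightarrow> T z"
  using reaches_euler[OF reaches_flow_map lip] .

text \<open>Exhibits the inverse flow, too, as a limit of measure-preserving maps, so that the limit
  inequality applies to it.\<close>

lemma euler_tendsto_flow_map_inverse: "(\<lambda>N. (euler_step F (- (1 / N)) ^^ N) z) \<longlonglongrightarrow> T_inv z"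
proof -
  have "(\<lambda>N. flip ((euler_step F (1 / N) ^^ N) (flip z))) \<longlonglongrightarrow> T_inv z"
    unfolding flip_def[of "(_ ^^ _) _"] flip_def[of "flow_map _ _"]
    by (intro tendsto_intros euler_tendsto_flow_map)
  then show ?thesis by (simp flip: euler_iterate_flip)
qed

lemma continuous_euler_iterate: "continuous_on UNIV (euler_step F h ^^ k)"
  by (intro continuous_on_funpow continuous_on_euler_step locally_lipschitz_continuous lip)

text \<open>A pointwise limit of continuous maps is Borel; this bypasses continuous dependence on
  initial data.\<close>

lemma borel_measurable_flow_map: "T \<in> borel_measurable borel"
  by (rule borel_measurable_LIMSEQ_metric[OF borel_measurable_continuous_onI[OF continuous_euler_iterate]
        euler_tendsto_flow_map])

lemma borel_measurable_flow_map_inverse: "T_inv \<in> borel_measurable borel"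
  by (rule borel_measurable_LIMSEQ_metric[OF borel_measurable_continuous_onI[OF continuous_euler_iterate]
        euler_tendsto_flow_map_inverse])

lemma emeasure_euler_iterate_eq:
  "A \<in> sets borel \<Longrightarrow> emeasure lborel ((euler_step F h ^^ k) -` A) = emeasure lborel A"
  by (rule emeasure_euler_iterate[OF locally_lipschitz_continuous[OF lip]])

lemma emeasure_flow_map_le:
  "A \<in> sets borel \<Longrightarrow> emeasure lborel (T -` A) \<le> emeasure lborel A"
  by (rule emeasure_vimage_limit_le[OF continuous_euler_iterate emeasure_euler_iterate_eq
        euler_tendsto_flow_map])

lemma emeasure_flow_map_inverse_le:
  "A \<in> sets borel \<Longrightarrow> emeasure lborel (T_inv -` A) \<le> emeasure lborel A"
  by (rule emeasure_vimage_limit_le[OF continuous_euler_iterate emeasure_euler_iterate_eq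
        euler_tendsto_flow_map_inverse])

end

section \<open>Invertible transformations that do not increase measure\<close>

text \<open>Passes from Borel sets to the completed measure underlying \<open>phase_measure\<close>.
  A Lebesgue set is a Borel set together with a subset of a Borel null set, and the bound forces
  preimages of null sets to be null.\<close>

lemma lebesgue_on_vimage:
  fixes T :: "'a::euclidean_space \<Rightarrow> 'a"
  assumes T: "T \<in> borel_measurable borel" and D: "D \<in> sets borel" and TD: "T ` D \<subseteq> D"
    and le: "\<And>A. A \<in> sets borel \<Longrightarrow> A \<subseteq> D \<Longrightarrow> emeasure lborel (T -` A \<inter> D) \<le> emeasure lborel A"
  shows "T \<in> measurable (lebesgue_on D) (lebesgue_on D)"
    and "\<And>A. A \<in> sets (lebesgue_on D) \<Longrightarrow>
           emeasure (lebesgue_on D) (T -` A \<inter> D) \<le> emeasure (lebesgue_on D) A"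
proof -
  have DL: "D \<in> sets lebesgue" using D by simp
  have main: "T -` A \<inter> D \<in> sets lebesgue \<and> emeasure lebesgue (T -` A \<inter> D) \<le> emeasure lebesgue A"
    if A: "A \<in> sets lebesgue" "A \<subseteq> D" for A
  proof -
    obtain S N N' where SN: "A = S \<union> N" "N \<subseteq> N'" "N' \<in> null_sets lborel" "S \<in> sets lborel"
      using sets_completionE[OF A(1)] by metis
    have S: "S \<in> sets borel" "S \<subseteq> D" using SN A by auto
    have N': "N' \<inter> D \<in> sets borel" "emeasure lborel (N' \<inter> D) = 0"
      using SN D null_set_Int2[of N' lborel D] by auto
    have pre: "T -` B \<inter> D \<in> sets borel" if "B \<in> sets borel" for B
      using measurable_sets_borel[OF T that] D by auto
    have null: "T -` (N' \<inter> D) \<inter> D \<in> null_sets lborel"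
      using le[OF N'(1)] N' pre[OF N'(1)] by (intro null_setsI) auto
    have eq: "T -` A \<inter> D = (T -` S \<inter> D) \<union> (T -` N \<inter> D)"
      using SN by auto
    have sub: "T -` N \<inter> D \<subseteq> T -` (N' \<inter> D) \<inter> D"
      using SN TD by auto
    have "T -` A \<inter> D \<in> sets lebesgue"
      by (rule sets_completionI[OF eq sub null]) (use pre[OF S(1)] in simp)
    moreover have "emeasure lebesgue (T -` A \<inter> D) \<le> emeasure lebesgue A"
    proof -
      have TS: "T -` S \<inter> D \<in> sets lebesgue" using pre[OF S(1)] by simp
      have TN: "T -` N \<inter> D \<in> null_sets lebesgue"
        using null sub by (meson null_sets_completion_subset null_sets_completionI)
      have "emeasure lebesgue (T -` A \<inter> D) = emeasure lebesgue (T -` S \<inter> D)"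
        unfolding eq by (rule emeasure_Un_null_set[OF TS TN])
      also have "\<dots> = emeasure lborel (T -` S \<inter> D)" using pre[OF S(1)] by simp
      also have "\<dots> \<le> emeasure lborel S" by (rule le[OF S])
      also have "\<dots> = emeasure lebesgue S" using S by simp
      also have "\<dots> \<le> emeasure lebesgue A" using A SN by (intro emeasure_mono) auto
      finally show ?thesis .
    qed
    ultimately show ?thesis ..
  qed
  show "T \<in> measurable (lebesgue_on D) (lebesgue_on D)"
  proof (rule measurableI)
    fix x assume "x \<in> space (lebesgue_on D)"
    then show "T x \<in> space (lebesgue_on D)" using TD by (auto simp: space_restrict_space)
  next
    fix A assume "A \<in> sets (lebesgue_on D)"
    with main[of A] DL show "T -` A \<inter> space (lebesgue_on D) \<in> sets (lebesgue_on D)"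
      by (auto simp: sets_restrict_space_iff space_restrict_space)
  qed
  show "emeasure (lebesgue_on D) (T -` A \<inter> D) \<le> emeasure (lebesgue_on D) A"
    if "A \<in> sets (lebesgue_on D)" for A
    using that main[of A] DL by (auto simp: sets_restrict_space_iff emeasure_restrict_space)
qed

text \<open>Invertibility makes measurability of \<open>h\<close> dispensable: otherwise both integrals are junk and equal \<open>0\<close>.\<close>

lemma integral_invariant:
  fixes h :: "'a \<Rightarrow> real"
  assumes T: "T \<in> measurable M M" and S: "S \<in> measurable M M"
    and inv: "\<And>z. z \<in> space M \<Longrightarrow> S (T z) = z" "\<And>z. z \<in> space M \<Longrightarrow> T (S z) = z"
    and le: "\<And>A. A \<in> sets M \<Longrightarrow> emeasure M (T -` A \<inter> space M) \<le> emeasure M A"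
      "\<And>A. A \<in> sets M \<Longrightarrow> emeasure M (S -` A \<inter> space M) \<le> emeasure M A"
  shows "integrable M (\<lambda>z. h (T z)) \<longleftrightarrow> integrable M h"
    and "(\<integral>z. h (T z) \<partial>M) = (\<integral>z. h z \<partial>M)"
proof -
  have distr: "distr M M T = M"
  proof (rule measure_eqI)
    fix A assume "A \<in> sets (distr M M T)"
    then have A: "A \<in> sets M" by simp
    \<comment> \<open>The bound for \<open>S\<close>, applied to the preimage under
      \<open>T\<close>, yields the inequality opposite to the bound for \<open>T\<close>.\<close>
    have "A = S -` (T -` A \<inter> space M) \<inter> space M"
      using sets.sets_into_space[OF A] inv measurable_space[OF S] by auto
    then have "emeasure M A \<le> emeasure M (T -` A \<inter> space M)"
      using le(2)[OF measurable_sets[OF T A]] by simp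
    then show "emeasure (distr M M T) A = emeasure M A"
      using le(1)[OF A] by (simp add: emeasure_distr[OF T A])
  qed simp
  have "integrable M (\<lambda>z. h (T z)) = integrable M h \<and> (\<integral>z. h (T z) \<partial>M) = (\<integral>z. h z \<partial>M)"
  proof (cases "h \<in> borel_measurable M")
    case True
    then show ?thesis
      using integrable_distr_eq[OF T, of h] integral_distr[OF T, of h] by (simp add: distr)
  next
    case False
    have "(\<lambda>z. h (T z)) \<notin> borel_measurable M"
    proof
      assume "(\<lambda>z. h (T z)) \<in> borel_measurable M"
      then have "(\<lambda>z. h (T (S z))) \<in> borel_measurable M"
        by (rule measurable_compose[OF S])
      then have "h \<in> borel_measurable M"
        by (rule measurable_cong[THEN iffD1, rotated]) (simp add: inv)
      with False show False ..
    qed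
    with False have "\<not> integrable M h" "\<not> integrable M (\<lambda>z. h (T z))"
      by (auto dest: borel_measurable_integrable)
    then show ?thesis by (simp add: not_integrable_integral_eq)
  qed
  then show "integrable M (\<lambda>z. h (T z)) \<longleftrightarrow> integrable M h"
    and "(\<integral>z. h (T z) \<partial>M) = (\<integral>z. h z \<partial>M)" by blast+
qed

section \<open>Reduction to the unit cell\<close>

text \<open>The lattice is indexed by the countable type \<open>int^'n\<close>, so unions over all
  its translates are countable unions.\<close>

definition int_vec :: "int^'n \<Rightarrow> real^'n" where
  "int_vec k = (\<chi> i. of_int (k $ i))"

definition floor_vec :: "real^'n \<Rightarrow> int^'n" where
  "floor_vec x = (\<chi> i. \<lfloor>x $ i\<rfloor>)"

text \<open>The projection onto the fundamental domain of the phase space of the torus; only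
  positions are reduced modulo the lattice.\<close>

definition wrap :: "(real^'n) \<times> (real^'n) \<Rightarrow> (real^'n) \<times> (real^'n)" where
  "wrap z = (fst z - int_vec (floor_vec (fst z)), snd z)"

lemma int_vec_uminus: "int_vec (- k) = - int_vec k"
  by (simp add: int_vec_def vec_eq_iff)

lemma floor_vec_add: "floor_vec (x + int_vec k) = floor_vec x + k"
  by (simp add: floor_vec_def int_vec_def vec_eq_iff)

lemma floor_vec_diff: "floor_vec (x - int_vec k) = floor_vec x - k"
  using floor_vec_add[of x "- k"] by (simp add: int_vec_uminus)

lemma cell_Torus_iff: "x \<in> cell Torus \<longleftrightarrow> floor_vec x = 0"
  by (simp add: floor_vec_def vec_eq_iff floor_eq_iff)

lemma wrap_translate: "wrap (z + (int_vec k, 0)) = wrap z"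
proof -
  have "int_vec (floor_vec (fst z) + k) = int_vec (floor_vec (fst z)) + int_vec k"
    by (simp add: int_vec_def vec_eq_iff)
  then show ?thesis by (simp add: wrap_def floor_vec_add)
qed

lemma wrap_mem: "wrap z \<in> cell Torus \<times> UNIV"
  by (simp add: wrap_def mem_Times_iff cell_Torus_iff floor_vec_diff del: cell.simps)

lemma wrap_id: "z \<in> cell Torus \<times> UNIV \<Longrightarrow> wrap z = z"
  by (simp add: wrap_def mem_Times_iff cell_Torus_iff int_vec_def vec_eq_iff prod_eq_iff del: cell.simps)

lemma borel_measurable_wrap: "wrap \<in> borel_measurable borel"
proof -
  have "(\<lambda>x::real^'n. int_vec (floor_vec x)) \<in> borel_measurable borel"
    unfolding borel_measurable_euclidean_space[where f = "\<lambda>x. int_vec (floor_vec x)"]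
    by (auto simp: Basis_vec_def inner_axis int_vec_def floor_vec_def
        intro!: borel_measurable_continuous_onI continuous_intros
          measurable_compose[OF _ borel_measurable_real_floor])
  then have "(\<lambda>z. int_vec (floor_vec (fst z))) \<in> borel_measurable (borel \<Otimes>\<^sub>M borel)"
    by (rule measurable_compose[OF measurable_fst])
  then show ?thesis
    unfolding wrap_def borel_prod[symmetric] by (intro measurable_Pair borel_measurable_diff) auto
qed

lemma borel_cell_Torus: "cell Torus \<times> UNIV \<in> sets (borel :: ((real^'n) \<times> (real^'n)) measure)"
proof -
  have "cell Torus = (\<Inter>i. {x::real^'n. 0 \<le> x $ i} \<inter> {x. x $ i < 1})"
    by auto
  moreover have "{x::real^'n. 0 \<le> x $ i} \<inter> {x. x $ i < 1} \<in> sets borel" for i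
    by (intro sets.Int borel_closed borel_open closed_Collect_le open_Collect_less continuous_intros)
  ultimately have "(cell Torus :: (real^'n) set) \<in> sets borel"
    by (simp add: sets.countable_INT'')
  then show ?thesis unfolding borel_prod[symmetric] by (intro pair_measureI) auto
qed

text \<open>
  Cut the left-hand set according to the lattice vector subtracted by \<open>wrap\<close>. By equivariance, the
  translates of the pieces are disjoint and fill \<open>T -` A\<close>.
\<close>

lemma emeasure_wrap_le:
  fixes T :: "(real^'n) \<times> (real^'n) \<Rightarrow> (real^'n) \<times> (real^'n)"
  assumes T: "T \<in> borel_measurable borel"
    and le: "\<And>A. A \<in> sets borel \<Longrightarrow> emeasure lborel (T -` A) \<le> emeasure lborel A"
    and equi: "\<And>z k. T (z + (int_vec k, 0)) = T z + (int_vec k, 0)"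
    and A: "A \<in> sets borel" "A \<subseteq> cell Torus \<times> UNIV"
  shows "emeasure lborel ((\<lambda>z. wrap (T z)) -` A \<inter> (cell Torus \<times> UNIV)) \<le> emeasure lborel A"
proof -
  let ?D = "cell Torus \<times> UNIV :: ((real^'n) \<times> (real^'n)) set"
  define \<tau> where "\<tau> k z = z + (int_vec k, 0 :: real^'n)" for k :: "int^'n" and z
  \<comment> \<open>\<open>X k\<close> holds the points of the cell whose image must be moved by
    \<open>- int_vec k\<close> to land in \<open>A\<close>; \<open>Y k\<close> is \<open>X k\<close>
    translated by \<open>- int_vec k\<close>.\<close>
  define X where "X k = ?D \<inter> T -` (\<tau> (- k) -` A)" for k
  define Y where "Y k = \<tau> k -` ?D \<inter> T -` A" for k
  have D: "?D \<in> sets borel" by (rule borel_cell_Torus)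
  have \<tau>m: "\<tau> k -` B \<in> sets borel" if "B \<in> sets borel" for k B
    unfolding \<tau>_def using that by (intro measurable_sets_borel) auto
  have Tm: "T -` B \<in> sets borel" if "B \<in> sets borel" for B
    using measurable_sets_borel[OF T that] .
  have XY: "X k = \<tau> (- k) -` Y k" for k
    using equi[of _ "- k"] by (auto simp: X_def Y_def \<tau>_def int_vec_uminus add.assoc)
  have Ym: "Y k \<in> sets borel" for k
    unfolding Y_def using \<tau>m[OF D] Tm[OF A(1)] by auto
  then have Xm: "X k \<in> sets borel" for k
    unfolding XY by (rule \<tau>m)
  have memD: "\<tau> k z \<in> ?D \<longleftrightarrow> k = - floor_vec (fst z)" for k z
  proof -
    have "\<tau> k z \<in> ?D \<longleftrightarrow> floor_vec (fst z) + k = 0"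
      by (simp add: \<tau>_def mem_Times_iff cell_Torus_iff floor_vec_add del: cell.simps)
    then show ?thesis by (simp add: eq_neg_iff_add_eq_0 add.commute)
  qed
  have \<tau>_wrap: "\<tau> (- floor_vec (fst z)) z = wrap z" for z
    by (simp add: \<tau>_def wrap_def int_vec_uminus plus_prod_def)
  have UX: "(\<lambda>z. wrap (T z)) -` A \<inter> ?D = (\<Union>k. X k)"
  proof (intro set_eqI iffI)
    fix z assume "z \<in> (\<lambda>z. wrap (T z)) -` A \<inter> ?D"
    then have "z \<in> X (floor_vec (fst (T z)))"
      unfolding X_def by (simp add: \<tau>_wrap del: cell.simps)
    then show "z \<in> (\<Union>k. X k)" by blast
  next
    fix z assume "z \<in> (\<Union>k. X k)"
    then obtain k where z: "z \<in> ?D" "\<tau> (- k) (T z) \<in> A" by (auto simp: X_def)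
    have "wrap (T z) = wrap (\<tau> (- k) (T z))"
      unfolding \<tau>_def by (rule wrap_translate[symmetric])
    also have "\<dots> = \<tau> (- k) (T z)" using z(2) A(2) by (intro wrap_id) blast
    finally show "z \<in> (\<lambda>z. wrap (T z)) -` A \<inter> ?D" using z by simp
  qed
  have UY: "(\<Union>k. Y k) = T -` A"
  proof (intro set_eqI iffI)
    fix z assume "z \<in> T -` A"
    then have "z \<in> Y (- floor_vec (fst z))"
      unfolding Y_def by (simp only: Int_iff vimage_eq memD)
    then show "z \<in> (\<Union>k. Y k)" by blast
  qed (auto simp: Y_def)
  have dX: "disjoint_family X"
  proof (unfold disjoint_family_on_def, intro ballI impI)
    fix k l :: "int^'n" assume "k \<noteq> l"
    \<comment> \<open>As \<open>A\<close> lies in the unit cell, the image point determines the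
      lattice vector.\<close>
    have "k = floor_vec (fst (T z))" if "z \<in> X k" for k z
    proof -
      have "\<tau> (- k) (T z) \<in> ?D" using that A(2) unfolding X_def by blast
      then show ?thesis unfolding memD by simp
    qed
    with \<open>k \<noteq> l\<close> show "X k \<inter> X l = {}" by blast
  qed
  have dY: "disjoint_family Y"
  proof (unfold disjoint_family_on_def, intro ballI impI)
    fix k l :: "int^'n" assume "k \<noteq> l"
    have "k = - floor_vec (fst z)" if "z \<in> Y k" for k z
    proof -
      have "\<tau> k z \<in> ?D" using that unfolding Y_def by blast
      then show ?thesis unfolding memD .
    qed
    with \<open>k \<noteq> l\<close> show "Y k \<inter> Y l = {}" by blast
  qed
  have XYm: "emeasure lborel (X k) = emeasure lborel (Y k)" for k
    using emeasure_lborel_translate[OF Ym[of k], of "(int_vec (- k), 0)"]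
    by (simp add: XY \<tau>_def vimage_def)
  have "emeasure lborel ((\<lambda>z. wrap (T z)) -` A \<inter> ?D) = (\<integral>\<^sup>+k. emeasure lborel (X k) \<partial>count_space UNIV)"
    unfolding UX using Xm dX by (intro emeasure_UN_countable) auto
  also have "\<dots> = (\<integral>\<^sup>+k. emeasure lborel (Y k) \<partial>count_space UNIV)"
    by (simp add: XYm)
  also have "\<dots> = emeasure lborel (T -` A)"
    unfolding UY[symmetric] using Ym dY by (intro emeasure_UN_countable[symmetric]) auto
  also have "\<dots> \<le> emeasure lborel A" by (rule le[OF A(1)])
  finally show ?thesis .
qed

section \<open>Existence of trajectories for Lipschitz forces\<close>

text \<open>
  In terms of \<open>u t = exp (- K * t) *\<^sub>R z t\<close> with \<open>K > L\<close>, Picard's operator is a contraction on all of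
  \<open>[0, 1]\<close>. Functions on \<open>[0, 1]\<close> are extended to the line by clamping the argument.
\<close>

lemma picard_lindelof:
  fixes G :: "'a::euclidean_space \<Rightarrow> 'a"
  assumes G: "L-lipschitz_on UNIV G"
  obtains z where "z 0 = z0" "\<And>t. t \<in> {0..1} \<Longrightarrow> (z has_vector_derivative G (z t)) (at t within {0..1})"
proof -
  \<comment> \<open>Strictly larger than \<open>L\<close>, which makes \<open>L / K\<close> a
    contraction constant, and positive even for \<open>L = 0\<close>.\<close>
  define K where "K = L + 1"
  have "0 \<le> L" using G by (rule lipschitz_on_nonneg)
  then have K: "0 < K" "L < K" by (auto simp: K_def)
  define J where "J u t = exp (- K * t) *\<^sub>R (z0 + integral {0..t} (\<lambda>s. G (exp (K * s) *\<^sub>R u s)))"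
    for u :: "real \<Rightarrow> 'a" and t
  define P where "P u = Bcontfun (\<lambda>t. J (apply_bcontfun u) (max 0 (min 1 t)))" for u :: "real \<Rightarrow>\<^sub>C 'a"
  have contG: "continuous_on S (\<lambda>s. G (exp (K * s) *\<^sub>R apply_bcontfun u s))" for u :: "real \<Rightarrow>\<^sub>C 'a" and S
    by (rule continuous_on_compose2[OF lipschitz_on_continuous_on[OF G]]) (auto intro!: continuous_intros)
  have contJ: "continuous_on {0..1} (J (apply_bcontfun u))" for u :: "real \<Rightarrow>\<^sub>C 'a"
    unfolding J_def
    by (intro continuous_intros indefinite_integral_continuous_1 integrable_continuous_real contG)
  have P: "apply_bcontfun (P u) = (\<lambda>t. J (apply_bcontfun u) (max 0 (min 1 t)))" for u :: "real \<Rightarrow>\<^sub>C 'a"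
    unfolding P_def
  proof (rule Bcontfun_inverse)
    have "bounded (J (apply_bcontfun u) ` {0..1})"
      using contJ by (intro compact_imp_bounded compact_continuous_image) auto
    moreover have "range (\<lambda>t. J (apply_bcontfun u) (max 0 (min 1 t))) \<subseteq> J (apply_bcontfun u) ` {0..1}"
      by auto
    ultimately have "bounded (range (\<lambda>t. J (apply_bcontfun u) (max 0 (min 1 t))))"
      by (rule bounded_subset)
    moreover have "continuous_on UNIV (\<lambda>t. J (apply_bcontfun u) (max 0 (min 1 t)))"
      by (rule continuous_on_compose2[OF contJ]) (auto intro!: continuous_intros)
    ultimately show "(\<lambda>t. J (apply_bcontfun u) (max 0 (min 1 t))) \<in> bcontfun"
      by (simp add: bcontfun_def)
  qed
  have contraction: "dist (P u) (P w) \<le> L / K * dist u w" for u w :: "real \<Rightarrow>\<^sub>C 'a"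
  proof (rule dist_bound)
    fix t :: real
    define r where "r = max 0 (min 1 t)"
    define d where "d = dist u w"
    have r: "0 \<le> r" by (simp add: r_def)
    let ?g = "\<lambda>u s. G (exp (K * s) *\<^sub>R apply_bcontfun u s)"
    \<comment> \<open>The Lipschitz bound on the integrands grows like \<open>exp (K * s)\<close>;
      its integral gains the factor \<open>1 / K\<close>, and the weight
      \<open>exp (- K * r)\<close> then cancels the growth.\<close>
    have exp_int: "((\<lambda>s. L * d * exp (K * s)) has_integral L * d / K * exp (K * r) - L * d / K * exp (K * 0)) {0..r}"
      using r K by (intro fundamental_theorem_of_calculus)
        (auto intro!: derivative_eq_intros simp flip: has_real_derivative_iff_has_vector_derivative)
    have "norm (integral {0..r} (\<lambda>s. ?g u s - ?g w s)) \<le> integral {0..r} (\<lambda>s. L * d * exp (K * s))"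
    proof (rule integral_norm_bound_integral)
      show "(\<lambda>s. ?g u s - ?g w s) integrable_on {0..r}"
        by (intro integrable_continuous_real continuous_intros contG)
      show "(\<lambda>s. L * d * exp (K * s)) integrable_on {0..r}"
        using exp_int by blast
      fix s
      have "norm (?g u s - ?g w s) \<le> L * norm (exp (K * s) *\<^sub>R apply_bcontfun u s - exp (K * s) *\<^sub>R apply_bcontfun w s)"
        by (rule lipschitz_on_normD[OF G]) auto
      also have "\<dots> = L * (exp (K * s) * dist (apply_bcontfun u s) (apply_bcontfun w s))"
        by (simp add: dist_norm flip: scaleR_diff_right)
      also have "\<dots> \<le> L * (exp (K * s) * d)"
        using \<open>0 \<le> L\<close> dist_bounded[of u s w] by (intro mult_left_mono) (auto simp: d_def)
      finally show "norm (?g u s - ?g w s) \<le> L * d * exp (K * s)" by (simp add: mult_ac)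
    qed
    also have "\<dots> = L * d / K * exp (K * r) - L * d / K"
      using integral_unique[OF exp_int] by simp
    also have "\<dots> \<le> L * d / K * exp (K * r)"
      using \<open>0 \<le> L\<close> K by (simp add: d_def)
    finally have i: "norm (integral {0..r} (\<lambda>s. ?g u s - ?g w s)) \<le> L * d / K * exp (K * r)" .
    have "dist (apply_bcontfun (P u) t) (apply_bcontfun (P w) t) =
        norm (exp (- K * r) *\<^sub>R (integral {0..r} (?g u) - integral {0..r} (?g w)))"
      by (simp add: P J_def dist_norm r_def flip: scaleR_diff_right)
    also have "integral {0..r} (?g u) - integral {0..r} (?g w) = integral {0..r} (\<lambda>s. ?g u s - ?g w s)"
      by (intro integral_diff[symmetric] integrable_continuous_real contG)
    also have "norm (exp (- K * r) *\<^sub>R \<dots>) \<le> exp (- K * r) * (L * d / K * exp (K * r))"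
      by (simp only: norm_scaleR) (rule mult_mono[OF _ i], auto)
    also have "\<dots> = L / K * d" by (simp add: exp_minus)
    finally show "dist (apply_bcontfun (P u) t) (apply_bcontfun (P w) t) \<le> L / K * dist u w"
      by (simp add: d_def)
  qed
  have "0 \<le> L / K" "L / K < 1" using \<open>0 \<le> L\<close> K by auto
  then obtain u where u: "P u = u"
    using banach_fix_type[of "L / K" P] contraction by blast
  define z where "z t = exp (K * t) *\<^sub>R apply_bcontfun u t" for t
  have z: "z t = z0 + integral {0..t} (\<lambda>s. G (z s))" if "t \<in> {0..1}" for t
  proof -
    have "apply_bcontfun u t = J (apply_bcontfun u) t"
      using that fun_cong[OF P[of u], of t] by (simp add: u)
    then show ?thesis by (simp add: z_def J_def exp_minus)
  qed
  show ?thesis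
  proof
    show "z 0 = z0" using z[of 0] by simp
    fix t :: real assume t: "t \<in> {0..1}"
    have "((\<lambda>t. integral {0..t} (\<lambda>s. G (z s))) has_vector_derivative G (z t)) (at t within {0..1})"
      using t contG unfolding z_def by (intro integral_has_vector_derivative)
    then have "((\<lambda>t. z0 + integral {0..t} (\<lambda>s. G (z s))) has_vector_derivative G (z t)) (at t within {0..1})"
      by (auto intro!: derivative_eq_intros)
    then show "(z has_vector_derivative G (z t)) (at t within {0..1})"
      by (rule has_vector_derivative_transform[OF t _ , rotated]) (simp add: z)
  qed
qed

text \<open>The second-order equation is the first-order system of the field \<open>(v, F x)\<close>
  on phase space, which inherits a global Lipschitz constant.\<close>

lemma reaches_exists:
  fixes F :: "'a::euclidean_space \<Rightarrow> 'a"
  assumes F: "L-lipschitz_on UNIV F"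
  shows "\<exists>w. reaches F z w"
proof -
  define G where "G z = (snd z, F (fst z))" for z :: "'a \<times> 'a"
  have "(1 + L)-lipschitz_on UNIV G"
  proof (rule lipschitz_onI)
    fix z w :: "'a \<times> 'a"
    have L: "0 \<le> L" using F by (rule lipschitz_on_nonneg)
    then show "0 \<le> 1 + L" by simp
    have "dist (G z) (G w) \<le> dist (snd z) (snd w) + dist (F (fst z)) (F (fst w))"
      unfolding G_def by (simp add: dist_Pair_Pair sqrt_sum_squares_le_sum)
    also have "\<dots> \<le> dist z w + L * dist z w"
      using lipschitz_onD[OF F, of "fst z" "fst w"] mult_left_mono[OF dist_fst_le L, of z w] dist_snd_le[of z w]
      by simp
    finally show "dist (G z) (G w) \<le> (1 + L) * dist z w" by (simp add: algebra_simps)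
  qed
  then obtain \<gamma> where \<gamma>: "\<gamma> 0 = z" "\<And>t. t \<in> {0..1} \<Longrightarrow> (\<gamma> has_vector_derivative G (\<gamma> t)) (at t within {0..1})"
    using picard_lindelof by metis
  have "trajectory F (\<lambda>t. fst (\<gamma> t)) (\<lambda>t. snd (\<gamma> t))"
    unfolding trajectory_def
    using bounded_linear.has_vector_derivative[OF bounded_linear_fst \<gamma>(2)]
      bounded_linear.has_vector_derivative[OF bounded_linear_snd \<gamma>(2)]
    by (simp add: G_def)
  with \<gamma>(1) show ?thesis unfolding reaches_def by fastforce
qed

section \<open>Gradients and Lipschitz constants\<close>

text \<open>The derivative is represented by the vector \<open>adjoint f' 1\<close>, which is the
  only candidate in the definite description \<open>grad\<close>. Any derivative found by the chain
  rule thereby identifies the gradient.\<close>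

lemma has_derivative_grad:
  fixes f :: "'a::euclidean_space \<Rightarrow> real"
  assumes "(f has_derivative f') (at x)"
  shows "f' h = h \<bullet> grad f x"
proof -
  define D where "D = adjoint f' 1"
  have "linear f'" using assms has_derivative_linear by blast
  then have f': "f' = (\<lambda>h. h \<bullet> D)"
    using adjoint_works[of f' _ 1] by (simp add: D_def fun_eq_iff)
  have "grad f x = D"
    unfolding grad_def
  proof (rule the_equality)
    show "GDERIV f x :> D" using assms by (simp add: gderiv_def f')
    fix D' assume "GDERIV f x :> D'"
    then have "(\<lambda>h. h \<bullet> D') = (\<lambda>h. h \<bullet> D)"
      using has_derivative_unique assms unfolding gderiv_def f' by blast
    then have "(D' - D) \<bullet> (D' - D) = 0" by (simp add: inner_diff_right fun_eq_iff)
    then show "D' = D" by simp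
  qed
  with f' show ?thesis by simp
qed

lemma differentiable_imp_has_derivative_grad:
  fixes f :: "'a::euclidean_space \<Rightarrow> real"
  assumes "f differentiable (at x)"
  shows "(f has_derivative (\<lambda>h. h \<bullet> grad f x)) (at x)"
  using assms has_derivative_grad unfolding differentiable_def by (metis (full_types) ext)

lemma frechet_derivative_grad:
  fixes f :: "'a::euclidean_space \<Rightarrow> real"
  assumes "f differentiable (at x)"
  shows "frechet_derivative f (at x) h = h \<bullet> grad f x"
  using frechet_derivative_at[OF differentiable_imp_has_derivative_grad[OF assms]] by metis

lemma grad_translate:
  fixes f :: "'a::euclidean_space \<Rightarrow> real"
  assumes f: "f differentiable (at (x + k))" and per: "\<And>x. f (x + k) = f x"
  shows "grad f (x + k) = grad f x"
proof -
  have "((\<lambda>y. f (y + k)) has_derivative (\<lambda>h. h \<bullet> grad f (x + k))) (at x)"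
    using differentiable_imp_has_derivative_grad[OF f]
    by (intro has_derivative_compose[where f = "\<lambda>y. y + k" and g = f]) (auto intro!: derivative_eq_intros)
  then have "\<And>h. h \<bullet> grad f (x + k) = h \<bullet> grad f x"
    unfolding per by (rule has_derivative_grad)
  then show ?thesis using vector_eq_ldot by blast
qed

text \<open>The gradient is continuous because its components are, hence bounded on the compact
  ball; convexity of the ball gives the Lipschitz bound.\<close>

lemma C1_locally_lipschitz:
  fixes f :: "'a::euclidean_space \<Rightarrow> real"
  assumes "Ck_on 1 f UNIV"
  shows "locally_lipschitz f"
  unfolding locally_lipschitz_def
proof
  fix R
  have diff: "f differentiable (at x)" for x using assms by simp
  have "continuous_on UNIV (\<lambda>x. frechet_derivative f (at x) b)" for b
    using assms by simp
  then have "continuous_on UNIV (\<lambda>x. grad f x \<bullet> b)" for b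
    by (simp add: frechet_derivative_grad[OF diff] inner_commute)
  then have "continuous_on UNIV (\<lambda>x. \<Sum>b\<in>Basis. (grad f x \<bullet> b) *\<^sub>R b)"
    by (intro continuous_on_sum continuous_on_scaleR continuous_on_const)
  then have "continuous_on UNIV (grad f)" by (simp add: euclidean_representation)
  then have "compact (grad f ` cball 0 R)"
    by (intro compact_continuous_image) (auto intro: continuous_on_subset)
  then obtain B where B: "0 < B" "\<And>x. x \<in> cball 0 R \<Longrightarrow> norm (grad f x) \<le> B"
    using compact_imp_bounded bounded_pos by (metis imageI)
  have "B-lipschitz_on (cball 0 R) f"
  proof (rule bounded_derivative_imp_lipschitz)
    fix x :: 'a assume x: "x \<in> cball 0 R"
    show "(f has_derivative (\<lambda>h. h \<bullet> grad f x)) (at x within cball 0 R)"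
      using differentiable_imp_has_derivative_grad[OF diff] has_derivative_at_withinI by blast
    show "onorm (\<lambda>h. h \<bullet> grad f x) \<le> B"
    proof (rule onorm_le)
      fix h
      show "norm (h \<bullet> grad f x) \<le> B * norm h"
        using Cauchy_Schwarz_ineq2[of h "grad f x"] mult_right_mono[OF B(2)[OF x] norm_ge_zero, of h]
        by (simp add: mult.commute)
    qed
  qed (use B in auto)
  then show "\<exists>L. L-lipschitz_on (cball 0 R) f" ..
qed

text \<open>Each component of the gradient is of class \<open>C^1\<close>; the Lipschitz constants
  of the components add up because the norm is at most the sum of the absolute coordinates.\<close>

lemma C2_locally_lipschitz_grad:
  fixes f :: "'a::euclidean_space \<Rightarrow> real"
  assumes f: "Ck_on 2 f UNIV"
  shows "locally_lipschitz (\<lambda>x. - grad f x)"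
  unfolding locally_lipschitz_def
proof
  fix R
  have diff: "f differentiable (at x)" for x using f by (simp add: numeral_2_eq_2)
  have "Ck_on 1 (\<lambda>x. frechet_derivative f (at x) b) UNIV" for b
    using f by (simp add: numeral_2_eq_2)
  then have "locally_lipschitz (\<lambda>x. b \<bullet> grad f x)" for b
    unfolding frechet_derivative_grad[OF diff] by (rule C1_locally_lipschitz)
  then have "\<forall>b. \<exists>L. L-lipschitz_on (cball 0 R) (\<lambda>x. b \<bullet> grad f x)"
    by (simp add: locally_lipschitz_def)
  from choice[OF this] obtain L where L: "\<And>b. (L b)-lipschitz_on (cball 0 R) (\<lambda>x. b \<bullet> grad f x)"
    by blast
  have "(\<Sum>b\<in>Basis. L b)-lipschitz_on (cball 0 R) (\<lambda>x. - grad f x)"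
  proof (rule lipschitz_onI)
    show "0 \<le> (\<Sum>b\<in>Basis. L b)" using L by (intro sum_nonneg lipschitz_on_nonneg)
    fix x y :: 'a assume xy: "x \<in> cball 0 R" "y \<in> cball 0 R"
    have "dist (- grad f x) (- grad f y) = norm (grad f x - grad f y)"
      by (simp add: dist_norm norm_minus_commute)
    also have "\<dots> \<le> (\<Sum>b\<in>Basis. \<bar>(grad f x - grad f y) \<bullet> b\<bar>)" by (rule norm_le_l1)
    also have "\<dots> \<le> (\<Sum>b\<in>Basis. L b * dist x y)"
      using lipschitz_onD[OF L xy]
      by (intro sum_mono) (simp add: dist_real_def inner_diff_left inner_commute[of "grad f _"])
    finally show "dist (- grad f x) (- grad f y) \<le> (\<Sum>b\<in>Basis. L b) * dist x y"
      by (simp add: sum_distrib_right)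
  qed
  then show "\<exists>L. L-lipschitz_on (cball 0 R) (\<lambda>x. - grad f x)" ..
qed

section \<open>Conserved quantities\<close>

lemma trajectory_at:
  assumes "trajectory F \<xi> \<eta>" "0 < t" "t < 1"
  shows "(\<xi> has_vector_derivative \<eta> t) (at t)" "(\<eta> has_vector_derivative F (\<xi> t)) (at t)"
proof -
  have "(\<xi> has_vector_derivative \<eta> t) (at t within {0..1}) \<and>
      (\<eta> has_vector_derivative F (\<xi> t)) (at t within {0..1})"
    using assms by (simp add: trajectory_def)
  then show "(\<xi> has_vector_derivative \<eta> t) (at t)" "(\<eta> has_vector_derivative F (\<xi> t)) (at t)"
    unfolding at_within_Icc_at[OF assms(2,3)] by blast+
qed

text \<open>The kinetic term changes at the rate
  \<open>- (\<eta> t \<bullet> grad V (\<xi> t))\<close> and the potential term at the opposite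
  rate.\<close>

lemma hamiltonian_conserved:
  assumes V: "\<And>x. V differentiable (at x)"
    and tr: "trajectory (\<lambda>x. - grad V x) \<xi> \<eta>"
  shows "hamiltonian V (\<xi> 1) (\<eta> 1) = hamiltonian V (\<xi> 0) (\<eta> 0)"
proof (rule DERIV_isconst_end[where f = "\<lambda>t. hamiltonian V (\<xi> t) (\<eta> t)"])
  have contV: "continuous_on UNIV V"
    using V differentiable_imp_continuous_within continuous_at_imp_continuous_on by blast
  show "continuous_on {0..1} (\<lambda>t. hamiltonian V (\<xi> t) (\<eta> t))"
    unfolding hamiltonian_def
    using trajectory_continuous[OF tr] continuous_on_compose2[OF contV, of "{0..1}" \<xi>]
    by (intro continuous_intros) auto
next
  fix t :: real assume t: "0 < t" "t < 1"
  note d = trajectory_at[OF tr t, unfolded has_vector_derivative_def]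
  have "((\<lambda>t. (\<eta> t \<bullet> \<eta> t) / 2 + V (\<xi> t)) has_derivative (\<lambda>s. 0)) (at t)"
    by (auto intro!: derivative_eq_intros d
        has_derivative_compose[OF d(1) differentiable_imp_has_derivative_grad[OF V]]
        simp: inner_commute)
  then show "((\<lambda>t. hamiltonian V (\<xi> t) (\<eta> t)) has_real_derivative 0) (at t)"
    by (simp add: has_field_derivative_def hamiltonian_def power2_norm_eq_inner lambda_zero)
qed simp

text \<open>The equation says that the derivative of \<open>\<rho>\<close> in the characteristic
  direction \<open>((v, - grad V x), 1)\<close> vanishes. It is used for times strictly between 0
  and 1; continuity carries constancy to both ends.\<close>

lemma liouville_solution_conserved:
  assumes sol: "liouville_solution X V f \<rho>"
    and tr: "trajectory (\<lambda>x. - grad V x) \<xi> \<eta>"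
  shows "\<rho> (\<xi> 1) (\<eta> 1) 1 = \<rho> (\<xi> 0) (\<eta> 0) 0"
proof (rule DERIV_isconst_end[where f = "\<lambda>t. \<rho> (\<xi> t) (\<eta> t) t"])
  let ?r = "\<lambda>((x, v), t). \<rho> x v t"
  have "continuous_on (UNIV \<times> {0..1}) ?r"
    using sol by (simp add: liouville_solution_def)
  moreover have "continuous_on {0..1} (\<lambda>t. ((\<xi> t, \<eta> t), t))"
    by (intro continuous_intros trajectory_continuous[OF tr])
  ultimately have "continuous_on {0..1} (\<lambda>t. ?r ((\<xi> t, \<eta> t), t))"
    by (rule continuous_on_compose2) auto
  then show "continuous_on {0..1} (\<lambda>t. \<rho> (\<xi> t) (\<eta> t) t)" by simp
next
  let ?r = "\<lambda>((x, v), t). \<rho> x v t"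
  fix t :: real assume t: "0 < t" "t < 1"
  define x v where "x = \<xi> t" and "v = \<eta> t"
  have "?r differentiable (at ((x, v), t))"
    using sol t by (auto simp: liouville_solution_def)
  then obtain D where D: "(?r has_derivative D) (at ((x, v), t))"
    unfolding differentiable_def by blast
  \<comment> \<open>The partial derivatives in the equation are now identified with the values of
    the total derivative \<open>D\<close> along \<open>t\<close>, \<open>x\<close> and
    \<open>v\<close>.\<close>
  interpret D: bounded_linear D using D by (rule has_derivative_bounded_linear)
  have "((\<lambda>s. ((x, v), s)) has_derivative (\<lambda>s. ((0, 0), s))) (at t)"
    by (intro has_derivative_Pair has_derivative_const has_derivative_ident)
  then have "((\<lambda>s. ?r ((x, v), s)) has_derivative (\<lambda>s. D ((0, 0), s))) (at t)"
    using D by (rule has_derivative_compose)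
  moreover have "(\<lambda>s. D ((0, 0), s)) = (\<lambda>s. D ((0, 0), 1) * s)"
  proof
    fix s
    show "D ((0, 0), s) = D ((0, 0), 1) * s"
      using D.scaleR[of s "((0, 0), 1)"] by (simp add: mult.commute)
  qed
  ultimately have "((\<lambda>s. \<rho> x v s) has_real_derivative D ((0, 0), 1)) (at t)"
    by (simp add: has_field_derivative_def)
  then have 1: "deriv (\<lambda>s. \<rho> x v s) t = D ((0, 0), 1)"
    by (rule DERIV_imp_deriv)
  have "((\<lambda>y. ((y, v), t)) has_derivative (\<lambda>h. ((h, 0), 0))) (at x)"
    by (intro has_derivative_Pair has_derivative_const has_derivative_ident)
  then have "((\<lambda>y. ?r ((y, v), t)) has_derivative (\<lambda>h. D ((h, 0), 0))) (at x)"
    using D by (rule has_derivative_compose)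
  then have 2: "D ((h, 0), 0) = h \<bullet> grad (\<lambda>y. \<rho> y v t) x" for h
    using has_derivative_grad[of "\<lambda>y. \<rho> y v t"] by simp
  have "((\<lambda>w. ((x, w), t)) has_derivative (\<lambda>h. ((0, h), 0))) (at v)"
    by (intro has_derivative_Pair has_derivative_const has_derivative_ident)
  then have "((\<lambda>w. ?r ((x, w), t)) has_derivative (\<lambda>h. D ((0, h), 0))) (at v)"
    using D by (rule has_derivative_compose)
  then have 3: "D ((0, h), 0) = h \<bullet> grad (\<lambda>w. \<rho> x w t) v" for h
    using has_derivative_grad[of "\<lambda>w. \<rho> x w t"] by simp
  have "((v, - grad V x), 1) = ((v, 0), 0) + ((0, - grad V x), 0) + ((0, 0), 1::real)"
    by simp
  then have "D ((v, - grad V x), 1) = D ((v, 0), 0) + D ((0, - grad V x), 0) + D ((0, 0), 1)"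
    by (simp only: D.add)
  also have "\<dots> = 0"
  proof -
    have "t \<in> {0<..<1}" using t by simp
    then have "deriv (\<lambda>s. \<rho> x v s) t + v \<bullet> grad (\<lambda>y. \<rho> y v t) x - grad V x \<bullet> grad (\<lambda>w. \<rho> x w t) v = 0"
      using sol unfolding liouville_solution_def by blast
    then show ?thesis unfolding 1[symmetric] 2 3 by simp
  qed
  finally have zero: "D ((v, - grad V x), 1) = 0" .
  note d = trajectory_at[OF tr t, unfolded has_vector_derivative_def]
  have "((\<lambda>t. ?r ((\<xi> t, \<eta> t), t)) has_derivative (\<lambda>s. D ((s *\<^sub>R v, s *\<^sub>R (- grad V x)), s))) (at t)"
    using D unfolding x_def v_def
    by (intro has_derivative_compose[where f = "\<lambda>t. ((\<xi> t, \<eta> t), t)" and g = ?r] has_derivative_Pair d has_derivative_ident)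
  moreover have "D ((s *\<^sub>R v, s *\<^sub>R (- grad V x)), s) = 0" for s
    using D.scaleR[of s "((v, - grad V x), 1)"] zero by (simp add: scaleR_prod_def)
  ultimately show "((\<lambda>t. \<rho> (\<xi> t) (\<eta> t) t) has_real_derivative 0) (at t)"
    by (simp add: has_field_derivative_def lambda_zero)
qed simp

section \<open>Periodic forces and the invariance of integrals\<close>

text \<open>Periodicity is given for unit steps along the axes. Iteration yields integer multiples
  of one axis vector, and summation over the axes every lattice vector.\<close>

lemma on_Torus_int_vec:
  fixes h :: "real^'n \<Rightarrow> 'b"
  assumes "on_position_space Torus h"
  shows "h (x + int_vec k) = h x"
proof -
  have nat: "h (x + real m *\<^sub>R axis i 1) = h x" for x i m
  proof (induction m)
    case (Suc m)
    have "h (x + real (Suc m) *\<^sub>R axis i 1) = h ((x + real m *\<^sub>R axis i 1) + axis i 1)"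
      by (simp add: algebra_simps)
    also have "\<dots> = h (x + real m *\<^sub>R axis i 1)" using assms by simp
    finally show ?case using Suc by simp
  qed simp
  have int: "h (x + of_int m *\<^sub>R axis i 1) = h x" for x i and m :: int
  proof (cases m rule: int_cases2)
    case (nonneg n)
    then show ?thesis using nat[of x n i] by simp
  next
    case (nonpos n)
    \<comment> \<open>A negative multiple is undone by the positive case, started at the shifted
      point.\<close>
    then show ?thesis using nat[of "x + of_int m *\<^sub>R axis i 1" n i] by simp
  qed
  have sum: "h (x + (\<Sum>i\<in>S. of_int (k $ i) *\<^sub>R axis i 1)) = h x" for S
  proof (induction S rule: infinite_finite_induct)
    case (insert i S)
    have "h (x + (\<Sum>i\<in>insert i S. of_int (k $ i) *\<^sub>R axis i 1)) =
        h ((x + (\<Sum>i\<in>S. of_int (k $ i) *\<^sub>R axis i 1)) + of_int (k $ i) *\<^sub>R axis i 1)"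
      using insert by (simp add: algebra_simps)
    also have "\<dots> = h x" using insert by (simp only: int)
    finally show ?case .
  qed simp_all
  have "int_vec k = (\<Sum>i\<in>UNIV. of_int (k $ i) *\<^sub>R axis i 1)"
    by (simp add: int_vec_def vec_eq_iff axis_def if_distrib cong: if_cong)
  with sum[of UNIV] show ?thesis by simp
qed

lemma norm_cell_Torus_le:
  fixes x :: "real^'n"
  assumes "floor_vec x = 0"
  shows "norm x \<le> CARD('n)"
proof -
  have "norm x \<le> (\<Sum>i\<in>UNIV. \<bar>x $ i\<bar>)" by (rule norm_le_l1_cart)
  also have "\<dots> \<le> (\<Sum>i::'n\<in>UNIV. 1)"
  proof (rule sum_mono)
    fix i
    have "0 \<le> x $ i \<and> x $ i < 1"
      using assms by (simp add: floor_vec_def vec_eq_iff floor_eq_iff)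
    then show "\<bar>x $ i\<bar> \<le> 1" by simp
  qed
  finally show ?thesis by simp
qed

text \<open>Points at distance at most 1 are moved by a common lattice vector into a fixed ball.
  More distant points are moved into the cell separately: there the difference of the values is
  bounded, while the original distance exceeds 1.\<close>

lemma periodic_lipschitz:
  fixes F :: "real^'n \<Rightarrow> 'b::real_normed_vector"
  assumes lip: "locally_lipschitz F" and per: "\<And>x k. F (x + int_vec k) = F x"
  shows "\<exists>L. L-lipschitz_on UNIV F"
proof -
  \<comment> \<open>Points of the cell have norm at most \<open>CARD('n)\<close>; the extra 1 makes
    room for a neighbour of such a point.\<close>
  define R where "R = real CARD('n) + 1"
  obtain L where L: "L-lipschitz_on (cball 0 R) F"
    using lip unfolding locally_lipschitz_def by blast
  have "0 \<le> L" using L by (rule lipschitz_on_nonneg)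
  have R: "1 \<le> R" by (simp add: R_def)
  have shift: "floor_vec (x + int_vec (- floor_vec x)) = 0" for x :: "real^'n"
    by (simp add: floor_vec_add)
  have ball: "norm (x + int_vec (- floor_vec x)) \<le> R - 1" for x :: "real^'n"
    using norm_cell_Torus_le[OF shift] by (simp add: R_def)
  have "(2 * R * L)-lipschitz_on UNIV F"
  proof (rule lipschitz_onI)
    show "0 \<le> 2 * R * L" using R \<open>0 \<le> L\<close> by simp
    fix x y :: "real^'n"
    show "dist (F x) (F y) \<le> 2 * R * L * dist x y"
    proof (cases "dist x y \<le> 1")
      case True
      let ?k = "int_vec (- floor_vec x)"
      have d: "dist (x + ?k) (y + ?k) = dist x y" by (simp add: dist_norm)
      have "norm (y + ?k) \<le> norm (x + ?k) + dist (x + ?k) (y + ?k)"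
        using norm_triangle_sub[of "y + ?k" "x + ?k"] by (simp add: dist_norm norm_minus_commute)
      then have "x + ?k \<in> cball 0 R" "y + ?k \<in> cball 0 R"
        using ball[of x] True d by auto
      from lipschitz_onD[OF L this] have "dist (F x) (F y) \<le> L * dist x y"
        by (simp only: per d)
      also have "\<dots> \<le> 2 * R * L * dist x y"
        using mult_right_mono[of 1 "2 * R" "L * dist x y"] R \<open>0 \<le> L\<close> by (simp add: mult.assoc)
      finally show ?thesis .
    next
      case False
      let ?x = "x + int_vec (- floor_vec x)" and ?y = "y + int_vec (- floor_vec y)"
      have "?x \<in> cball 0 R" "?y \<in> cball 0 R" using ball[of x] ball[of y] by auto
      from lipschitz_onD[OF L this] have "dist (F x) (F y) \<le> L * dist ?x ?y"
        by (simp only: per)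
      also have "dist ?x ?y \<le> 2 * R"
        using norm_triangle_ineq4[of ?x ?y] ball[of x] ball[of y] by (simp only: dist_norm)
      then have "L * dist ?x ?y \<le> 2 * R * L * 1"
        using mult_left_mono[OF _ \<open>0 \<le> L\<close>] by (metis mult.commute mult.right_neutral)
      also have "\<dots> \<le> 2 * R * L * dist x y"
        using False R \<open>0 \<le> L\<close> by (intro mult_left_mono) auto
      finally show ?thesis .
    qed
  qed
  then show ?thesis ..
qed

section \<open>Invariance of integrals over phase space\<close>

lemma phase_measure_Euclidean: "phase_measure Euclidean = lebesgue_on UNIV"
  by (simp add: phase_measure_def)

text \<open>The inner \<open>wrap\<close> changes \<open>S z\<close> by a lattice vector, which
  passes through \<open>T\<close> by equivariance and is removed by the outer
  \<open>wrap\<close>.\<close>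

lemma wrap_wrap_inverse:
  assumes inv: "\<And>z. T (S z) = z"
    and equi: "\<And>z k. T (z + (int_vec k, 0)) = T z + (int_vec k, 0)"
    and z: "z \<in> cell Torus \<times> UNIV"
  shows "wrap (T (wrap (S z))) = z"
proof -
  define k where "k = - floor_vec (fst (S z))"
  have "wrap (S z) = S z + (int_vec k, 0)"
    by (simp add: wrap_def k_def int_vec_uminus plus_prod_def)
  then show ?thesis by (simp only: equi inv wrap_translate wrap_id[OF z])
qed

text \<open>On the torus the transformation of the cell is the flow followed by \<open>wrap\<close>,
  which the periodic function \<open>h\<close> does not see.\<close>

lemma flow_map_integral_invariant:
  fixes F :: "real^'n \<Rightarrow> real^'n" and h :: "(real^'n) \<times> (real^'n) \<Rightarrow> real"
  assumes "complete_newton_flow F"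
    and F: "\<And>x k. X = Torus \<Longrightarrow> F (x + int_vec k) = F x"
    and h: "\<And>z k. X = Torus \<Longrightarrow> h (z + (int_vec k, 0)) = h z"
  shows "integrable (phase_measure X) (\<lambda>z. h (flow_map F z)) \<longleftrightarrow> integrable (phase_measure X) h"
    and "(\<integral>z. h (flow_map F z) \<partial>phase_measure X) = (\<integral>z. h z \<partial>phase_measure X)"
proof -
  interpret complete_newton_flow F by fact
  have "(integrable (phase_measure X) (\<lambda>z. h (T z)) \<longleftrightarrow> integrable (phase_measure X) h) \<and>
    (\<integral>z. h (T z) \<partial>phase_measure X) = (\<integral>z. h z \<partial>phase_measure X)"
  proof (cases X)
    case Euclidean
    note 1 = lebesgue_on_vimage[OF borel_measurable_flow_map, of UNIV]
    note 2 = lebesgue_on_vimage[OF borel_measurable_flow_map_inverse, of UNIV]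
    show ?thesis
      unfolding Euclidean phase_measure_Euclidean
      using integral_invariant[of T "lebesgue_on UNIV" T_inv h] 1 2
      by (simp add: flow_map_inverse flow_map_inverse' emeasure_flow_map_le emeasure_flow_map_inverse_le)
  next
    case Torus
    let ?D = "cell Torus \<times> UNIV :: ((real^'n) \<times> (real^'n)) set"
    have T_equi: "T (z + (int_vec k, 0)) = T z + (int_vec k, 0)" for z k
      by (rule flow_map_translate) (rule F[OF Torus])
    have T_inv_equi: "T_inv (z + (int_vec k, 0)) = T_inv z + (int_vec k, 0)" for z k
    proof -
      have flip: "flip (w + (int_vec k, 0)) = flip w + (int_vec k, 0)" for w :: "(real^'n) \<times> (real^'n)"
        by (simp add: flip_def plus_prod_def)
      show ?thesis by (simp only: flip T_equi)
    qed
    have h_wrap: "h (wrap z) = h z" for z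
      using h[OF Torus, of z "- floor_vec (fst z)"]
      by (simp add: wrap_def int_vec_uminus plus_prod_def)
    have meas: "(\<lambda>z. wrap (U z)) \<in> borel_measurable borel"
      if "U \<in> borel_measurable borel" for U :: "(real^'n) \<times> (real^'n) \<Rightarrow> (real^'n) \<times> (real^'n)"
      using that borel_measurable_wrap by (rule measurable_compose)
    note 1 = lebesgue_on_vimage[OF meas[OF borel_measurable_flow_map] borel_cell_Torus _
        emeasure_wrap_le[OF borel_measurable_flow_map emeasure_flow_map_le T_equi]]
    note 2 = lebesgue_on_vimage[OF meas[OF borel_measurable_flow_map_inverse] borel_cell_Torus _
        emeasure_wrap_le[OF borel_measurable_flow_map_inverse emeasure_flow_map_inverse_le T_inv_equi]]
    have sub: "(\<lambda>z. wrap (U z)) ` ?D \<subseteq> ?D" for U :: "(real^'n) \<times> (real^'n) \<Rightarrow> (real^'n) \<times> (real^'n)"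
      using wrap_mem by blast
    have sp: "space (lebesgue_on ?D) = ?D" by (simp add: space_restrict_space del: cell.simps)
    have inv: "wrap (T_inv (wrap (T z))) = z" "wrap (T (wrap (T_inv z))) = z" if "z \<in> ?D" for z
      using wrap_wrap_inverse[OF flow_map_inverse T_inv_equi that]
        wrap_wrap_inverse[OF flow_map_inverse' T_equi that] by auto
    note 3 = integral_invariant[of "\<lambda>z. wrap (T z)" "lebesgue_on ?D" "\<lambda>z. wrap (T_inv z)" h,
        unfolded sp, OF 1(1)[OF sub] 2(1)[OF sub] inv 1(2)[OF sub] 2(2)[OF sub]]
    show ?thesis
      unfolding Torus phase_measure_def using 3 unfolding h_wrap by blast
  qed
  then show "integrable (phase_measure X) (\<lambda>z. h (T z)) \<longleftrightarrow> integrable (phase_measure X) h"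
    and "(\<integral>z. h (T z) \<partial>phase_measure X) = (\<integral>z. h z \<partial>phase_measure X)"
    by blast+
qed

lemma characteristics_exist_reaches:
  assumes "characteristics_exist V"
  shows "\<exists>w. reaches (\<lambda>x. - grad V x) z w"
proof -
  obtain \<xi> \<eta> where "\<xi> 0 = fst z" "\<eta> 0 = snd z" "trajectory (\<lambda>x. - grad V x) \<xi> \<eta>"
    using assms unfolding characteristics_exist_def trajectory_def by metis
  then have "reaches (\<lambda>x. - grad V x) z (\<xi> 1, \<eta> 1)"
    unfolding reaches_def by (intro exI[of _ \<xi>] exI[of _ \<eta>]) auto
  then show ?thesis ..
qed

theorem proposition2p2:
  fixes X :: position_space
    and f g :: "(real^'n) \<times> (real^'n) \<Rightarrow> real"
    and V :: "real^'n \<Rightarrow> real"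
    and \<rho> :: "real^'n \<Rightarrow> real^'n \<Rightarrow> real \<Rightarrow> real"
  assumes f: "smooth_positive_density X f"
    and g: "smooth_positive_density X g"
    and mass: "(\<integral>\<^sup>+z. ennreal (f z) \<partial>phase_measure X) = (\<integral>\<^sup>+z. ennreal (g z) \<partial>phase_measure X)"
    and V: "on_position_space X V" "Ck_on 2 V UNIV"
    and flow: "X = Euclidean \<Longrightarrow> characteristics_exist V"
    and sol: "liouville_solution X V f \<rho>"
    and final: "\<forall>x v. \<rho> x v 1 = g (x, v)"
  shows "\<forall>\<Phi> :: real \<Rightarrow> real. \<Phi> \<in> borel_measurable lebesgue \<longrightarrow>
     (integrable (phase_measure X) (\<lambda>(x, v). \<Phi> (hamiltonian V x v) * f (x, v)) \<longleftrightarrow>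
      integrable (phase_measure X) (\<lambda>(x, v). \<Phi> (hamiltonian V x v) * g (x, v))) \<and>
     (\<integral>(x, v). \<Phi> (hamiltonian V x v) * f (x, v) \<partial>phase_measure X) =
     (\<integral>(x, v). \<Phi> (hamiltonian V x v) * g (x, v) \<partial>phase_measure X)"
proof (intro allI impI)
  fix \<Phi> :: "real \<Rightarrow> real"
  define F where "F = (\<lambda>x. - grad V x)"
  have diff: "V differentiable (at x)" for x
    using V(2) by (simp add: numeral_2_eq_2)
  have lip: "locally_lipschitz F"
    unfolding F_def by (rule C2_locally_lipschitz_grad[OF V(2)])
  have V_per: "V (x + int_vec k) = V x" if "X = Torus" for x k
    using V(1) that on_Torus_int_vec by blast
  have F_per: "F (x + int_vec k) = F x" if "X = Torus" for x k
    unfolding F_def using grad_translate[OF diff V_per[OF that]] by simp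
  have "\<exists>w. reaches F z w" for z
  proof (cases X)
    case Euclidean
    then show ?thesis unfolding F_def by (intro characteristics_exist_reaches flow)
  next
    case Torus
    then show ?thesis using periodic_lipschitz[OF lip F_per] reaches_exists by blast
  qed
  with lip have newton: "complete_newton_flow F" by unfold_locales
  then interpret complete_newton_flow F .
  have conserved: "hamiltonian V (fst (T z)) (snd (T z)) = hamiltonian V (fst z) (snd z)"
    "g (T z) = f z" for z
  proof -
    obtain \<xi> \<eta> where tr: "trajectory F \<xi> \<eta>" and ends: "z = (\<xi> 0, \<eta> 0)" "T z = (\<xi> 1, \<eta> 1)"
      using reaches_flow_map[of z] by (auto simp: reaches_def)
    show "hamiltonian V (fst (T z)) (snd (T z)) = hamiltonian V (fst z) (snd z)"
      \<comment> \<open>\<open>T z\<close> is rewritten first, since replacing \<open>z\<close>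
        would destroy that term.\<close>
      unfolding ends(2) unfolding ends(1) fst_conv snd_conv
      by (rule hamiltonian_conserved[OF diff tr[unfolded F_def]])
    have "\<rho> x v 0 = f (x, v)" for x v
      using sol by (simp add: liouville_solution_def)
    then show "g (T z) = f z"
      unfolding ends(2) unfolding ends(1)
      using liouville_solution_conserved[OF sol tr[unfolded F_def]] final by simp
  qed
  \<comment> \<open>The integrand at time 1; by the conservation laws its composition with
    \<open>T\<close> is the integrand at time 0.\<close>
  define h where "h z = \<Phi> (hamiltonian V (fst z) (snd z)) * g z" for z
  have h_per: "h (z + (int_vec k, 0)) = h z" if "X = Torus" for z k
  proof -
    have "on_position_space X (\<lambda>x v. g (x, v))"
      using g by (simp add: smooth_positive_density_def)
    \<comment> \<open>Periodicity in the position is applied to a map with values in functions of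
      the velocity.\<close>
    then have "(\<lambda>v. g (x + int_vec k, v)) = (\<lambda>v. g (x, v))" for x
      using that on_Torus_int_vec[of "\<lambda>x v. g (x, v)"] by blast
    then have "g (x + int_vec k, v) = g (x, v)" for x v by metis
    then show ?thesis
      by (cases z) (simp add: h_def hamiltonian_def V_per[OF that])
  qed
  have "(\<lambda>z. h (T z)) = (\<lambda>(x, v). \<Phi> (hamiltonian V x v) * f (x, v))"
    "h = (\<lambda>(x, v). \<Phi> (hamiltonian V x v) * g (x, v))"
    using conserved by (auto simp: h_def fun_eq_iff)
  with flow_map_integral_invariant[OF newton F_per h_per]
  show "(integrable (phase_measure X) (\<lambda>(x, v). \<Phi> (hamiltonian V x v) * f (x, v)) \<longleftrightarrow>
      integrable (phase_measure X) (\<lambda>(x, v). \<Phi> (hamiltonian V x v) * g (x, v))) \<and>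
     (\<integral>(x, v). \<Phi> (hamiltonian V x v) * f (x, v) \<partial>phase_measure X) =
     (\<integral>(x, v). \<Phi> (hamiltonian V x v) * g (x, v) \<partial>phase_measure X)"
    by simp
qed

end
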